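(* Let $d\ge2$. (1) Let $y\in\ell^\infty(\mathbb Z^d)$ with $\rho(y)\in X_{\mathscr I_d^3}$. Then there is a unique $c(y)\in[0,1)$ such that $f^{(d)}\cdot y+\tilde c(y)\in\ell^\infty(\mathbb Z^d,\mathbb Z)$, where $\tilde c(y)$ is the constant sequence with value $c(y)$; and for every constant integer sequence $\tilde m$, $$v=f^{(d)}\cdot y+\tilde c(y)+\tilde m\in K_d.$$ (2) Let $\Gamma\subset\mathbb Z^d$ be a subgroup of finite index. An element $v\in\ell^\infty(\mathbb Z^d,\mathbb Z)$ which is $\Gamma$-invariant (i.e. $v_{\mathbf n+\boldsymbol\gamma}=v_{\mathbf n}$ for all $\boldsymbol\gamma\in\Gamma$, $\mathbf n\in\mathbb Z^d$) lies in $K_d$ if and only if it is of the form in (1) with $y\in\ell^\infty(\mathbb Z^d)$ $\Gamma$-invariant, $\rho(y)\in X_{\mathscr I_d^3}$, and $\tilde m$ a constant integer sequence.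
   Context: $R_d=\mathbb Z[u_1^{\pm1},\dots,u_d^{\pm1}]$; sequences identified with formal series; $(a\cdot b)_{\mathbf n}=\sum_{\mathbf k}a_{\mathbf k}b_{\mathbf n-\mathbf k}$ when defined; $w^*_{\mathbf n}=w_{-\mathbf n}$. $f^{(d)}=2d-\sum_i(u_i+u_i^{-1})$. $w^{(2)}_{\mathbf n}=\int_{\mathbb T^2}(e^{-2\pi i\langle\mathbf n,\mathbf t\rangle}-1)/F^{(2)}(\mathbf t)\,d\mathbf t$; for $d\ge3$, $w^{(d)}_{\mathbf n}=\int_{\mathbb T^d}e^{-2\pi i\langle\mathbf n,\mathbf t\rangle}/F^{(d)}(\mathbf t)\,d\mathbf t$, $F^{(d)}(\mathbf t)=2d-2\sum_j\cos(2\pi t_j)$. $I_d=\{g\in R_d:g\cdot w^{(d)}\in\ell^1(\mathbb Z^d)\}$; $\mathscr I_d=\{h\in R_d:h(1,\dots,1)=0\}$. $\rho$ = reduction mod 1 into $\mathbb T^{\mathbb Z^d}$; $(\alpha^{\mathbf m}x)_{\mathbf n}=x_{\mathbf m+\mathbf n}$, $h(\alpha)=\sum h_{\mathbf m}\alpha^{\mathbf m}$; for an ideal $J\subset R_d$, $X_J=\{x\in\mathbb T^{\mathbb Z^d}:g(\alpha)(x)=0\ \forall g\in J\}$. For $g\in I_d$ and $v\in\ell^\infty(\mathbb Z^d,\mathbb Z)$, $\xi_g(v)=\rho((g^*\cdot w^{(d)})\cdot v)$, and $K_d=\bigcap_{g\in I_d}\ker\xi_g$. *)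

theory Defs
  imports "HOL-Analysis.Analysis"
begin

text \<open>Points of Z^d are represented as int^'d, where 'd is a finite index type
with CARD('d) = d. Real sequences indexed by Z^d are functions int^'d => real.
Elements of R_d (Laurent polynomials) are finitely supported functions int^'d => int
(coefficient of u^n at n).\<close>

definition lpoly :: "(int^'d \<Rightarrow> int) \<Rightarrow> bool" where
  "lpoly g \<longleftrightarrow> finite {n. g n \<noteq> 0}"

definition Rd :: "(int^'d \<Rightarrow> int) set" where
  "Rd = {g. lpoly g}"

definition lpmult :: "(int^'d \<Rightarrow> int) \<Rightarrow> (int^'d \<Rightarrow> int) \<Rightarrow> (int^'d \<Rightarrow> int)" where
  "lpmult a b = (\<lambda>n. \<Sum>k\<in>{k. a k \<noteq> 0}. a k * b (n - k))"

definition conv :: "(int^'d \<Rightarrow> real) \<Rightarrow> (int^'d \<Rightarrow> real) \<Rightarrow> (int^'d \<Rightarrow> real)" where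
  "conv a b = (\<lambda>n. \<Sum>\<^sub>\<infinity>k. a k * b (n - k))"

definition rseq :: "(int^'d \<Rightarrow> int) \<Rightarrow> (int^'d \<Rightarrow> real)" where
  "rseq g = (\<lambda>n. real_of_int (g n))"

definition star :: "(int^'d \<Rightarrow> 'a) \<Rightarrow> (int^'d \<Rightarrow> 'a)" where
  "star w = (\<lambda>n. w (- n))"

text \<open>f^(d) = 2d - sum_i (u_i + u_i^(-1)).\<close>
definition fd :: "int^'d \<Rightarrow> int" where
  "fd n = (if n = 0 then 2 * int CARD('d)
           else if (\<exists>i. n = axis i 1 \<or> n = axis i (-1)) then -1 else 0)"

definition Fd :: "real^'d \<Rightarrow> real" where
  "Fd t = 2 * real CARD('d) - 2 * (\<Sum>j\<in>UNIV. cos (2 * pi * t $ j))"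

definition ipr :: "int^'d \<Rightarrow> real^'d \<Rightarrow> real" where
  "ipr n t = (\<Sum>j\<in>UNIV. real_of_int (n $ j) * t $ j)"

text \<open>The integral over T^d = [0,1]^d (Lebesgue); the value is real, we take Re.\<close>
definition wd :: "int^'d \<Rightarrow> real" where
  "wd n = (if CARD('d) = 2 then
      Re (LINT t : cbox (0::real^'d) One | lborel.
            (exp (- (2 * pi * \<i> * complex_of_real (ipr n t))) - 1) / complex_of_real (Fd t))
    else
      Re (LINT t : cbox (0::real^'d) One | lborel.
            exp (- (2 * pi * \<i> * complex_of_real (ipr n t))) / complex_of_real (Fd t)))"

definition Iw :: "(int^'d \<Rightarrow> int) set" where
  "Iw = {g. lpoly g \<and> (\<lambda>n. \<bar>conv (rseq g) wd n\<bar>) summable_on UNIV}"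

definition augId :: "(int^'d \<Rightarrow> int) set" where
  "augId = {h. lpoly h \<and> (\<Sum>m\<in>{m. h m \<noteq> 0}. h m) = 0}"

inductive_set ideal_gen :: "(int^'d \<Rightarrow> int) set \<Rightarrow> (int^'d \<Rightarrow> int) set"
  for S where
  zero: "(\<lambda>_. 0) \<in> ideal_gen S"
| gen_mult: "s \<in> S \<Longrightarrow> lpoly r \<Longrightarrow> p \<in> ideal_gen S \<Longrightarrow>
      (\<lambda>n. lpmult r s n + p n) \<in> ideal_gen S"

definition augId3 :: "(int^'d \<Rightarrow> int) set" where
  "augId3 = ideal_gen {lpmult (lpmult h1 h2) h3 | h1 h2 h3. h1 \<in> augId \<and> h2 \<in> augId \<and> h3 \<in> augId}"

text \<open>rho(y) \<in> X_J: for all g in J, g(alpha)(rho y) = 0 in T^(Z^d), i.e.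
  sum_m g_m y_(m+n) \<in> Z for all n.\<close>
definition rho_in_X :: "(int^'d \<Rightarrow> int) set \<Rightarrow> (int^'d \<Rightarrow> real) \<Rightarrow> bool" where
  "rho_in_X J y \<longleftrightarrow> (\<forall>g\<in>J. \<forall>n. (\<Sum>m\<in>{m. g m \<noteq> 0}. real_of_int (g m) * y (m + n)) \<in> \<int>)"

definition linf :: "(int^'d \<Rightarrow> real) set" where
  "linf = {y. \<exists>B. \<forall>n. \<bar>y n\<bar> \<le> B}"

definition linf_int :: "(int^'d \<Rightarrow> real) set" where
  "linf_int = {v. v \<in> linf \<and> (\<forall>n. v n \<in> \<int>)}"

text \<open>K_d = intersection over g in I_d of ker xi_g, xi_g(v) = rho((g^* . w) . v).\<close>
definition Kd :: "(int^'d \<Rightarrow> real) set" where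
  "Kd = {v. v \<in> linf_int \<and>
        (\<forall>g\<in>Iw. \<forall>n. conv (conv (rseq (star g)) wd) v n \<in> \<int>)}"

definition finite_index_subgroup :: "(int^'d) set \<Rightarrow> bool" where
  "finite_index_subgroup G \<longleftrightarrow> 0 \<in> G \<and> (\<forall>a\<in>G. \<forall>b\<in>G. a + b \<in> G) \<and> (\<forall>a\<in>G. - a \<in> G)
     \<and> finite (range (\<lambda>n. (\<lambda>g. n + g) ` G))"

definition invariant :: "(int^'d) set \<Rightarrow> (int^'d \<Rightarrow> 'a) \<Rightarrow> bool" where
  "invariant G v \<longleftrightarrow> (\<forall>\<gamma>\<in>G. \<forall>n. v (n + \<gamma>) = v n)"

end

theory Submission
  imports Defs "HOL-Library.Poly_Mapping" "HOL-Real_Asymp.Real_Asymp"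
begin

text \<open>Write \<open>f = 4 d (1 - \<mu>)\<close>, where \<open>\<mu>\<close> is the law of a lazy random walk step. The Green function
  satisfies \<open>f w = \<delta>\<close>, and \<open>k w = (1 / 4 d) (\<Sum>N. k \<mu>^N)\<close> whenever \<open>k (1,\<dots>,1) = 0\<close>. Each factor from the
  augmentation ideal gains \<open>N^(-1/2)\<close> in the \<open>l^1\<close>-norm of \<open>\<mu>^N\<close>, so for \<open>k\<close> in its cube
  the series converges in \<open>l^1\<close> and \<open>k w\<close> has sum 0. Conversely, if \<open>a = g w\<close> is summable then
  \<open>f a = g\<close>, and comparing both sides near the trivial character gives the moments of \<open>g\<close> up to
  order two: with \<open>A\<close> the sum of \<open>a\<close>, an integer, those of \<open>g - A f\<close> vanish. If the third
  differences of \<open>y\<close> are integral, \<open>y\<close> is a quadratic polynomial modulo 1, so \<open>g - A f\<close> maps it to an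
  integral sequence, which is the first assertion. For the converse on periodic points one solves
  \<open>f y = v - b\<close> by a geometric series, since a power of \<open>\<mu>\<close> halves the oscillation of
  periodic functions.\<close>

section \<open>Finitely supported functions acting on sequences\<close>

hide_const (open) Poly_Mapping.range Poly_Mapping.map

text \<open>The walk is lazy for two reasons: its Fourier multiplier 1 - F/(4 d) lies in [0, 1], so
  its powers tend to 0 off the zeros of F without oscillating; and half of the mass rests, so a
  component (1 + U)/2 can be split off for each unit step U. Two factors from the augmentation ideal
  would only give the order 1/N, hence the cube.

  Let a = g w have sum A. The pairing of a with f y + b is g y + b A, where neither term need be
  integral. It equals (g - A f) y + A (f y + b), whose second term is integral once A and f y + b
  are. This is why A has to be an integer and why g is corrected by A f. Membership of g - A f in
  the cube is bypassed: a quadratic polynomial modulo 1 is seen only through moments up to order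
  two. In the converse direction A is 0 on the cube, so the unknown constant b of the Poisson
  equation drops out.

  For d = 2 the constant subtracted in the definition of w is annihilated by the augmentation ideal,
  which contains f; so both definitions of w are treated together.\<close>

abbreviation lookup where "lookup \<equiv> Poly_Mapping.lookup"
abbreviation keys where "keys \<equiv> Poly_Mapping.keys"
abbreviation single where "single \<equiv> Poly_Mapping.single"

text \<open>Convolution by a finitely supported element. \<open>poly_mapping\<close> supplies a
  commutative ring, so operator identities reduce to ring algebra; by \<open>act_mult\<close> they
  hold on every real sequence, without growth conditions, hence also on \<open>wd\<close>.\<close>

definition act :: "('a::ab_group_add \<Rightarrow>\<^sub>0 real) \<Rightarrow> ('a \<Rightarrow> real) \<Rightarrow> 'a \<Rightarrow> real" where
  "act p v n = (\<Sum>k\<in>keys p. lookup p k * v (n - k))"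

definition l1 :: "('a::ab_group_add \<Rightarrow>\<^sub>0 real) \<Rightarrow> real" where
  "l1 p = (\<Sum>k\<in>keys p. \<bar>lookup p k\<bar>)"

lemma act_superset:
  assumes "finite S" "keys p \<subseteq> S"
  shows "act p v n = (\<Sum>k\<in>S. lookup p k * v (n - k))"
  unfolding act_def using assms by (intro sum.mono_neutral_left) (auto simp: in_keys_iff)

lemma l1_superset:
  assumes "finite S" "keys p \<subseteq> S"
  shows "l1 p = (\<Sum>k\<in>S. \<bar>lookup p k\<bar>)"
  unfolding l1_def using assms by (intro sum.mono_neutral_left) (auto simp: in_keys_iff)

lemma act_zero [simp]: "act 0 v n = 0"
  by (simp add: act_def)

lemma act_single [simp]: "act (single a c) v n = c * v (n - a)"
  by (subst act_superset[of "{a}"]) auto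

lemma act_one [simp]: "act 1 v n = v n"
  using act_single[of 0 1 v n] by simp

lemma act_add: "act (p + q) v n = act p v n + act q v n"
proof -
  define S where "S = keys p \<union> keys q"
  have S: "finite S" "keys p \<subseteq> S" "keys q \<subseteq> S" "keys (p + q) \<subseteq> S"
    unfolding S_def using Poly_Mapping.keys_add[of p q] by auto
  show ?thesis
    by (simp add: act_superset[OF S(1,2)] act_superset[OF S(1,3)] act_superset[OF S(1,4)]
        lookup_add sum.distrib distrib_right)
qed

lemma act_uminus: "act (- p) v n = - act p v n"
  by (simp add: act_def sum_negf)

lemma act_diff: "act (p - q) v n = act p v n - act q v n"
  using act_add[of p "- q"] by (simp add: act_uminus)

lemma act_sum: "act (sum p I) v n = (\<Sum>i\<in>I. act (p i) v n)"
  by (induction I rule: infinite_finite_induct) (auto simp: act_add)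

lemma pm_decompose: fixes p :: "'a \<Rightarrow>\<^sub>0 real" shows "p = (\<Sum>k\<in>keys p. single k (lookup p k))"
proof (rule poly_mapping_eqI)
  fix n
  have "lookup (\<Sum>k\<in>keys p. single k (lookup p k)) n
      = (\<Sum>k\<in>keys p. if k = n then lookup p k else 0)"
    unfolding lookup_sum by (intro sum.cong) (auto simp: lookup_single when_def)
  also have "\<dots> = lookup p n"
    by (simp add: sum.delta in_keys_iff)
  finally show "lookup p n = lookup (\<Sum>k\<in>keys p. single k (lookup p k)) n" by simp
qed

lemma pm_induct [case_names zero single add]:
  assumes "P 0" "\<And>a c. P (single a c)" "\<And>p q. P p \<Longrightarrow> P q \<Longrightarrow> P (p + q)"
  shows "P (p :: 'a \<Rightarrow>\<^sub>0 real)"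
proof -
  have "P (\<Sum>k\<in>S. single k (lookup p k))" for S
    by (induction S rule: infinite_finite_induct) (auto intro: assms)
  then show ?thesis by (subst pm_decompose) 
qed

lemma act_mult: "act (p * q) v n = act p (act q v) n"
proof (induction p arbitrary: n rule: pm_induct)
  case (single a c)
  show ?case
  proof (induction q arbitrary: n rule: pm_induct)
    case (single b e)
    then show ?case by (simp add: mult_single diff_diff_eq algebra_simps)
  qed (simp_all add: act_add distrib_left)
qed (simp_all add: act_add distrib_right)

lemma act_diff_right: "act p (\<lambda>n. u n - v n) n = act p u n - act p v n"
  by (simp add: act_def right_diff_distrib sum_subtractf)

lemma act_scale_right: "act p (\<lambda>n. c * v n) n = c * act p v n"
  by (simp add: act_def sum_distrib_left mult_ac)

lemma act_const: "act p (\<lambda>_. c) n = c * act p (\<lambda>_. 1) 0"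
  by (simp add: act_def sum_distrib_left mult_ac)

lemma act_shift: "act p (\<lambda>n. v (n + a)) n = act p v (n + a)"
  by (simp add: act_def add_diff_eq algebra_simps)

lemma lookup_eq_act: "lookup p n = act p (\<lambda>n. if n = 0 then 1 else 0) n"
proof -
  have "act p (\<lambda>n. if n = 0 then 1 else 0) n = (\<Sum>k\<in>keys p. if k = n then lookup p k else 0)"
    unfolding act_def by (intro sum.cong) auto
  then show ?thesis by (simp add: sum.delta in_keys_iff)
qed

section \<open>The l^1-norm on the group algebra\<close>

lemma l1_nonneg: "0 \<le> l1 p"
  by (simp add: l1_def sum_nonneg)

lemma l1_single [simp]: "l1 (single a c) = \<bar>c\<bar>"
  by (subst l1_superset[of "{a}"]) auto

lemma l1_zero [simp]: "l1 0 = 0"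
  by (simp add: l1_def)

lemma l1_one [simp]: "l1 1 = 1"
  using l1_single[of 0 1] by simp

lemma l1_add: "l1 (p + q) \<le> l1 p + l1 q"
proof -
  define S where "S = keys p \<union> keys q"
  have S: "finite S" "keys p \<subseteq> S" "keys q \<subseteq> S" "keys (p + q) \<subseteq> S"
    unfolding S_def using Poly_Mapping.keys_add[of p q] by auto
  show ?thesis
    unfolding l1_superset[OF S(1,2)] l1_superset[OF S(1,3)] l1_superset[OF S(1,4)]
    by (auto simp: lookup_add sum.distrib[symmetric] intro!: sum_mono)
qed

lemma l1_uminus [simp]: "l1 (- p) = l1 p"
  by (simp add: l1_def)

lemma l1_sum: "l1 (sum p I) \<le> (\<Sum>i\<in>I. l1 (p i))"
proof (induction I rule: infinite_finite_induct)
  case (insert x F)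
  then show ?case using l1_add[of "p x" "sum p F"] by simp
qed auto

lemma l1_single_mult: "l1 (single a c * q) \<le> \<bar>c\<bar> * l1 q"
proof -
  have "single a c * q = (\<Sum>k\<in>keys q. single (a + k) (c * lookup q k))"
    by (subst pm_decompose[of q]) (simp add: sum_distrib_left mult_single)
  then have "l1 (single a c * q) \<le> (\<Sum>k\<in>keys q. l1 (single (a + k) (c * lookup q k)))"
    by (simp only: l1_sum)
  also have "\<dots> = \<bar>c\<bar> * l1 q"
    unfolding l1_single by (simp add: l1_def sum_distrib_left abs_mult)
  finally show ?thesis .
qed

lemma l1_mult: "l1 (p * q) \<le> l1 p * l1 q"
proof -
  have "p * q = (\<Sum>k\<in>keys p. single k (lookup p k) * q)"
    by (subst pm_decompose[of p]) (simp add: sum_distrib_right)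
  then have "l1 (p * q) \<le> (\<Sum>k\<in>keys p. l1 (single k (lookup p k) * q))"
    by (simp add: l1_sum)
  also have "\<dots> \<le> (\<Sum>k\<in>keys p. \<bar>lookup p k\<bar> * l1 q)"
    by (intro sum_mono l1_single_mult)
  finally show ?thesis by (simp add: l1_def sum_distrib_right)
qed

lemma l1_power_le_one: "l1 p \<le> 1 \<Longrightarrow> l1 (p ^ n) \<le> 1"
proof (induction n)
  case (Suc n)
  then have "l1 p * l1 (p ^ n) \<le> 1 * 1"
    by (intro mult_mono) (auto simp: l1_nonneg)
  then show ?case using l1_mult[of p "p ^ n"] by simp
qed auto

lemma act_bound:
  assumes "\<And>n. \<bar>v n\<bar> \<le> B"
  shows "\<bar>act p v n\<bar> \<le> l1 p * B"
proof -
  have "\<bar>act p v n\<bar> \<le> (\<Sum>k\<in>keys p. \<bar>lookup p k\<bar> * \<bar>v (n - k)\<bar>)"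
    unfolding act_def by (rule order.trans[OF sum_abs]) (simp add: abs_mult)
  also have "\<dots> \<le> (\<Sum>k\<in>keys p. \<bar>lookup p k\<bar> * B)"
    using assms by (intro sum_mono mult_left_mono) auto
  finally show ?thesis by (simp add: l1_def sum_distrib_right)
qed

section \<open>Smoothing by binomial laws\<close>

text \<open>Discrete differentiation of the binomial law: \<open>n (1 - U) (1 + U)^(n-1)\<close> has
  coefficients \<open>(n - 2 j) (n choose j)\<close>, so Cauchy--Schwarz reduces the bound to the variance.\<close>

lemma l1_binomial_difference:
  fixes a :: "'a::ab_group_add"
  assumes n: "n > 0"
  defines "U \<equiv> single a (1::real)"
  shows "l1 ((1 - U) * (1 + U) ^ (n - 1)) \<le> 2 ^ n / sqrt n"
proof -
  obtain m where m: "n = Suc m" using n by (cases n) auto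
  \<comment> \<open>Iterating \<open>(+) a\<close> stands for the j-fold multiple of
    \<open>a\<close> in the additive group.\<close>
  have Upow: "U ^ j = single (((+) a ^^ j) 0) 1" for j
    by (induction j) (auto simp: U_def mult_single single_one)
  have cmult: "of_nat c * U ^ j = single (((+) a ^^ j) 0) (real c)" for c j
    unfolding Upow by (simp add: single_of_nat[symmetric] mult_single del: single_of_nat)
  have e1: "(1 + U) ^ n = (\<Sum>j\<le>n. of_nat (n choose j) * U ^ j)"
    using binomial_ring[of U 1 n] by (simp add: add.commute)
  have "(\<Sum>j\<le>n. of_nat (j * (n choose j)) * U ^ j)
      = (\<Sum>j\<le>m. of_nat (Suc j * (Suc m choose Suc j)) * U ^ Suc j)"
    unfolding m by (subst sum.atMost_Suc_shift) simp
  also have "\<dots> = (\<Sum>j\<le>m. of_nat n * U * (of_nat (m choose j) * U ^ j))"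
    by (intro sum.cong refl) (simp only: Suc_times_binomial m of_nat_mult power_Suc mult_ac)
  also have "\<dots> = of_nat n * U * (1 + U) ^ m"
    using binomial_ring[of U 1 m] by (simp add: add.commute sum_distrib_left)
  finally have e2: "(\<Sum>j\<le>n. of_nat (j * (n choose j)) * U ^ j) = of_nat n * U * (1 + U) ^ m" .
  have "of_nat n * ((1 - U) * (1 + U) ^ m) = of_nat n * (1 + U) ^ n - 2 * (of_nat n * U * (1 + U) ^ m)"
    by (simp add: m algebra_simps)
  also have "\<dots> = (\<Sum>j\<le>n. of_nat n * (of_nat (n choose j) * U ^ j) - 2 * (of_nat (j * (n choose j)) * U ^ j))"
    by (simp only: e1 e2[symmetric] sum_distrib_left sum_subtractf)
  also have "\<dots> = (\<Sum>j\<le>n. single (((+) a ^^ j) 0) ((real n - 2 * real j) * real (n choose j)))"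
  proof (intro sum.cong refl)
    fix j
    have "of_nat n * (of_nat (n choose j) * U ^ j) - 2 * (of_nat (j * (n choose j)) * U ^ j)
       = of_nat (n * (n choose j)) * U ^ j - of_nat (2 * j * (n choose j)) * U ^ j"
      by (simp add: mult_ac)
    also have "\<dots> = single (((+) a ^^ j) 0) (real (n * (n choose j)) - real (2 * j * (n choose j)))"
      by (simp only: cmult single_diff)
    finally show "of_nat n * (of_nat (n choose j) * U ^ j) - 2 * (of_nat (j * (n choose j)) * U ^ j)
       = single (((+) a ^^ j) 0) ((real n - 2 * real j) * real (n choose j))"
      by (simp add: algebra_simps)
  qed
  finally have e3: "of_nat n * ((1 - U) * (1 + U) ^ m)
      = (\<Sum>j\<le>n. single (((+) a ^^ j) 0) ((real n - 2 * real j) * real (n choose j)))" .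
  define X where "X = (1 - U) * (1 + U) ^ m"
  have "X = single 0 (1 / real n) * (of_nat n * X)"
    using n by (simp add: single_of_nat[symmetric] mult_single mult.assoc[symmetric] del: single_of_nat)
  then have "l1 X \<le> \<bar>1 / real n\<bar> * l1 (of_nat n * X)"
    using l1_single_mult by metis
  also have "l1 (of_nat n * X) \<le> (\<Sum>j\<le>n. \<bar>real n - 2 * real j\<bar> * real (n choose j))"
    unfolding X_def e3 by (rule order.trans[OF l1_sum]) (simp add: abs_mult)
  also have "(\<Sum>j\<le>n. \<bar>real n - 2 * real j\<bar> * real (n choose j)) \<le> 2 ^ n * sqrt n"
  proof -
    \<comment> \<open>Bernstein polynomials at 1/2 are the fair binomial weights; their known
      zeroth, first and second factorial moments give the mean of (n - 2 j)^2, which is n.\<close>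
    have B: "Bernstein n j (1/2) = real (n choose j) / 2 ^ n" if "j \<le> n" for j
      using that by (simp add: Bernstein_def power_add[symmetric] power_one_over field_simps)
    have "(\<Sum>j\<le>n. \<bar>real n - 2 * real j\<bar> * Bernstein n j (1/2))\<^sup>2
        = (\<Sum>j\<le>n. (\<bar>real n - 2 * real j\<bar> * sqrt (Bernstein n j (1/2))) * sqrt (Bernstein n j (1/2)))\<^sup>2"
      by (simp add: mult.assoc Bernstein_nonneg)
    also have "\<dots> \<le> (\<Sum>j\<le>n. (\<bar>real n - 2 * real j\<bar> * sqrt (Bernstein n j (1/2)))\<^sup>2) * (\<Sum>j\<le>n. (sqrt (Bernstein n j (1/2)))\<^sup>2)"
      by (rule Cauchy_Schwarz_ineq_sum)
    also have "\<dots> = (\<Sum>j\<le>n. (real n - 2 * real j)\<^sup>2 * Bernstein n j (1/2))"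
      by (simp add: power_mult_distrib Bernstein_nonneg)
    also have "\<dots> = (\<Sum>j\<le>n. (real n)\<^sup>2 * Bernstein n j (1/2) + 4 * (real j * (real j - 1) * Bernstein n j (1/2))
         - (4 * real n - 4) * (real j * Bernstein n j (1/2)))"
      by (intro sum.cong refl) (simp add: power2_eq_square algebra_simps)
    also have "\<dots> = (real n)\<^sup>2 * 1 + 4 * (real n * (real n - 1) * (1/2)\<^sup>2) - (4 * real n - 4) * (real n * (1/2))"
      by (simp only: sum_subtractf sum.distrib sum_distrib_left[symmetric] sum_Bernstein sum_k_Bernstein sum_kk_Bernstein)
    also have "\<dots> = real n" by (simp add: power2_eq_square algebra_simps)
    finally have "(\<Sum>j\<le>n. \<bar>real n - 2 * real j\<bar> * Bernstein n j (1/2)) \<le> sqrt n"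
      by (rule real_le_rsqrt)
    moreover have "(\<Sum>j\<le>n. \<bar>real n - 2 * real j\<bar> * Bernstein n j (1/2))
        = (\<Sum>j\<le>n. \<bar>real n - 2 * real j\<bar> * real (n choose j)) / 2 ^ n"
      unfolding sum_divide_distrib by (intro sum.cong) (auto simp: B)
    ultimately have "(\<Sum>j\<le>n. \<bar>real n - 2 * real j\<bar> * real (n choose j)) / 2 ^ n \<le> sqrt n"
      by simp
    then show ?thesis by (subst (asm) pos_divide_le_eq) (auto simp: mult.commute)
  qed
  also have "\<bar>1 / real n\<bar> * (2 ^ n * sqrt n) = 2 ^ n / sqrt n"
    using n by (simp add: field_simps)
  finally show ?thesis by (simp add: X_def m divide_le_cancel)
qed

text \<open>For binomial K this bounds the mean of (K + 1)^(-1/2). Cauchy--Schwarz reduces it to the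
  mean of 1/(K + 1), which the absorption identity for binomial coefficients turns into the binomial
  law for N + 1 without its term at 0.\<close>

lemma binomial_average_inverse_sqrt:
  assumes q: "0 < q" "q \<le> (1::real)"
  shows "(\<Sum>k\<le>N. Bernstein N k q / sqrt (Suc k)) \<le> 1 / sqrt (q * Suc N)"
proof -
  have "(\<Sum>k\<le>N. Bernstein N k q / real (Suc k)) * (q * Suc N)
      = (\<Sum>k\<le>N. Bernstein (Suc N) (Suc k) q)"
    unfolding sum_distrib_right
  proof (intro sum.cong refl)
    fix k
    have "real (Suc k) * real (Suc N choose Suc k) = real (Suc N) * real (N choose k)"
      by (metis Suc_times_binomial of_nat_mult)
    then have "real (N choose k) * real (Suc N) / real (Suc k) = real (Suc N choose Suc k)"
      by (simp add: field_simps del: of_nat_Suc binomial_Suc_Suc)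
    then show "Bernstein N k q / real (Suc k) * (q * Suc N) = Bernstein (Suc N) (Suc k) q"
      unfolding Bernstein_def by (simp add: field_simps del: of_nat_Suc binomial_Suc_Suc)
  qed
  also have "\<dots> \<le> (\<Sum>k\<le>Suc N. Bernstein (Suc N) k q)"
    using q by (subst sum.atMost_Suc_shift) (simp add: Bernstein_nonneg del: sum_Bernstein sum.atMost_Suc)
  also have "\<dots> = 1" by (rule sum_Bernstein)
  finally have 1: "(\<Sum>k\<le>N. Bernstein N k q / real (Suc k)) \<le> 1 / (q * Suc N)"
    using q by (simp add: field_simps del: of_nat_Suc)
  have b: "Bernstein N k q \<ge> 0" for k using q by (simp add: Bernstein_nonneg)
  have "(\<Sum>k\<le>N. Bernstein N k q / sqrt (Suc k))\<^sup>2
     = (\<Sum>k\<le>N. (sqrt (Bernstein N k q) / sqrt (Suc k)) * sqrt (Bernstein N k q))\<^sup>2"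
    using b by simp
  also have "\<dots> \<le> (\<Sum>k\<le>N. (sqrt (Bernstein N k q) / sqrt (Suc k))\<^sup>2) * (\<Sum>k\<le>N. (sqrt (Bernstein N k q))\<^sup>2)"
    by (rule Cauchy_Schwarz_ineq_sum)
  also have "\<dots> = (\<Sum>k\<le>N. Bernstein N k q / real (Suc k))"
    using b by (simp add: power_divide del: of_nat_Suc)
  also note 1
  finally have "(\<Sum>k\<le>N. Bernstein N k q / sqrt (Suc k)) \<le> sqrt (1 / (q * Suc N))"
    by (rule real_le_rsqrt)
  then show ?thesis by (simp only: real_sqrt_divide real_sqrt_one)
qed

text \<open>The lazy random walk with a step towards \<open>a\<close>: condition on the number \<open>k\<close> of
  times the component \<open>q (1 + U) / 2\<close> is chosen.\<close>

lemma l1_lazy_walk_difference: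
  fixes a :: "'a::ab_group_add" and q :: real
  assumes q: "0 < q" "q \<le> 1"
  defines "U \<equiv> single a (1::real)"
  assumes L: "l1 (M - single 0 (q / 2) * (1 + U)) \<le> 1 - q"
  shows "l1 ((U - 1) * M ^ N) \<le> 2 / sqrt (q * Suc N)"
proof -
  \<comment> \<open>\<open>S\<close> is q times the fair two-point law and \<open>L\<close> the
    rest; the weights \<open>Bernstein N k q\<close> will come from q^k and the bound (1 - q)^(N -
    k).\<close>
  define L where "L = M - single 0 (q / 2) * (1 + U)"
  define S where "S = single 0 (q / 2) * (1 + U)"
  have Spow: "S ^ k = single 0 ((q / 2) ^ k) * (1 + U) ^ k" for k
  proof -
    have "single (0::'a) (q/2) ^ k = single 0 ((q / 2) ^ k)"
      by (induction k) (auto simp: mult_single single_one)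
    then show ?thesis by (simp add: S_def power_mult_distrib)
  qed
  have Lpow: "l1 (L ^ k) \<le> (1 - q) ^ k" for k
  proof (induction k)
    case (Suc k)
    have "l1 (L ^ Suc k) \<le> l1 L * l1 (L ^ k)" by (simp add: l1_mult)
    also have "\<dots> \<le> (1 - q) * (1 - q) ^ k"
      using assms(4) Suc q by (intro mult_mono) (auto simp: L_def l1_nonneg)
    finally show ?case by simp
  qed auto
  have "M = S + L" by (simp add: S_def L_def)
  then have "(1 - U) * M ^ N = (\<Sum>k\<le>N. (1 - U) * (of_nat (N choose k) * S ^ k * L ^ (N - k)))"
    by (simp add: binomial_ring sum_distrib_left)
  also have "\<dots> = (\<Sum>k\<le>N. single 0 (real (N choose k) * (q / 2) ^ k) * (((1 - U) * (1 + U) ^ k) * L ^ (N - k)))"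
    (is "_ = (\<Sum>k\<le>N. ?t k)")
  proof (intro sum.cong refl)
    fix k
    have "of_nat (N choose k) = single (0::'a) (real (N choose k))" by simp
    then show "(1 - U) * (of_nat (N choose k) * S ^ k * L ^ (N - k)) = ?t k"
      unfolding Spow by (simp add: mult_single[of 0 _ 0, simplified, symmetric] mult_ac del: single_of_nat)
  qed
  finally have "l1 ((1 - U) * M ^ N) \<le> (\<Sum>k\<le>N. l1 (?t k))"
    by (simp add: l1_sum)
  also have "\<dots> \<le> (\<Sum>k\<le>N. 2 * (Bernstein N k q / sqrt (Suc k)))"
  proof (intro sum_mono)
    fix k
    have "l1 (?t k) \<le> \<bar>real (N choose k) * (q / 2) ^ k\<bar> * l1 (((1 - U) * (1 + U) ^ k) * L ^ (N - k))"
      by (rule l1_single_mult)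
    also have "\<dots> \<le> \<bar>real (N choose k) * (q / 2) ^ k\<bar> * (l1 ((1 - U) * (1 + U) ^ k) * l1 (L ^ (N - k)))"
      by (intro mult_left_mono l1_mult) auto
    also have "\<dots> \<le> \<bar>real (N choose k) * (q / 2) ^ k\<bar> * ((2 ^ Suc k / sqrt (Suc k)) * (1 - q) ^ (N - k))"
      using l1_binomial_difference[of "Suc k" a] Lpow q
      by (intro mult_left_mono mult_mono) (auto simp: U_def l1_nonneg)
    also have "\<dots> = 2 * (Bernstein N k q / sqrt (Suc k))"
      using q by (simp add: Bernstein_def power_divide field_simps)
    finally show "l1 (?t k) \<le> 2 * (Bernstein N k q / sqrt (Suc k))" .
  qed
  also have "\<dots> \<le> 2 * (1 / sqrt (q * Suc N))"
    unfolding sum_distrib_left[symmetric]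
    using binomial_average_inverse_sqrt[OF q] by (intro mult_left_mono) auto
  finally have "l1 ((1 - U) * M ^ N) \<le> 2 / sqrt (q * Suc N)" by simp
  moreover have "(U - 1) * M ^ N = - ((1 - U) * M ^ N)" by (simp add: algebra_simps)
  ultimately show ?thesis by (simp only: l1_uminus)
qed

section \<open>The lazy random walk generated by the Laplacian\<close>

text \<open>\<open>Abs_poly_mapping\<close> is meaningful only for finite support, hence the
  \<open>lpoly\<close> premises of the lemmas on \<open>toP\<close>.\<close>

definition toP :: "(int^'d \<Rightarrow> int) \<Rightarrow> (int^'d \<Rightarrow>\<^sub>0 real)" where
  "toP g = Abs_poly_mapping (rseq g)"

lemma lookup_toP: "lpoly g \<Longrightarrow> lookup (toP g) n = real_of_int (g n)"
  by (simp add: toP_def lpoly_def rseq_def)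

lemma keys_toP: "lpoly g \<Longrightarrow> keys (toP g) = {k. g k \<noteq> 0}"
  by (auto simp: in_keys_iff lookup_toP)

lemma act_toP: "lpoly g \<Longrightarrow> act (toP g) v n = (\<Sum>k\<in>{k. g k \<noteq> 0}. real_of_int (g k) * v (n - k))"
  by (simp add: act_def keys_toP lookup_toP)

lemma conv_rseq: "lpoly g \<Longrightarrow> conv (rseq g) v = act (toP g) v"
proof (rule ext)
  fix n assume g: "lpoly g"
  have "conv (rseq g) v n = (\<Sum>\<^sub>\<infinity>k\<in>{k. g k \<noteq> 0}. rseq g k * v (n - k))"
    unfolding conv_def by (intro infsum_cong_neutral) (auto simp: rseq_def)
  also have "\<dots> = (\<Sum>k\<in>{k. g k \<noteq> 0}. rseq g k * v (n - k))"
    using g by (intro infsum_finite) (simp add: lpoly_def)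
  finally show "conv (rseq g) v n = act (toP g) v n"
    using g by (simp add: act_toP rseq_def)
qed

lemma lpmult_rseq: "lpoly a \<Longrightarrow> rseq (lpmult a b) n = act (toP a) (rseq b) n"
  by (simp add: rseq_def lpmult_def act_toP)

lemma rseq_eq_lookup: "lpoly g \<Longrightarrow> rseq g = lookup (toP g)"
  by (auto simp: lookup_toP rseq_def)

lemma lookup_mult_eq_act: "lookup (p * q) n = act p (lookup q) n"
proof -
  have "lookup r = act r (\<lambda>n. if n = 0 then 1 else 0)" for r :: "'a \<Rightarrow>\<^sub>0 real"
    by (rule ext) (rule lookup_eq_act)
  then show ?thesis by (simp only: act_mult)
qed

lemma lpoly_lpmult:
  assumes "lpoly a" "lpoly b"
  shows "lpoly (lpmult a b)" and toP_lpmult: "toP (lpmult a b) = toP a * toP b"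
proof -
  have "real_of_int (lpmult a b n) = lookup (toP a * toP b) n" for n
    using lpmult_rseq[OF assms(1), of b n] rseq_eq_lookup[OF assms(2)]
    by (simp add: lookup_mult_eq_act rseq_def)
  then have eq: "rseq (lpmult a b) = lookup (toP a * toP b)" by (auto simp: rseq_def)
  have "{n. lpmult a b n \<noteq> 0} = {n. rseq (lpmult a b) n \<noteq> 0}" by (simp add: rseq_def)
  then show "lpoly (lpmult a b)" by (simp add: lpoly_def eq)
  show "toP (lpmult a b) = toP a * toP b"
    unfolding toP_def[of "lpmult a b"] eq by simp
qed

lemma lpoly_add:
  assumes "lpoly a" "lpoly b"
  shows "lpoly (\<lambda>n. a n + b n)" and toP_add: "toP (\<lambda>n. a n + b n) = toP a + toP b"
proof -
  have eq: "rseq (\<lambda>n. a n + b n) = lookup (toP a + toP b)"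
    using assms by (auto simp: rseq_def lookup_add lookup_toP)
  have "{n. a n + b n \<noteq> 0} = {n. rseq (\<lambda>n. a n + b n) n \<noteq> 0}"
    by (simp add: rseq_def of_int_add[symmetric] del: of_int_add)
  then show "lpoly (\<lambda>n. a n + b n)" by (simp add: lpoly_def eq)
  show "toP (\<lambda>n. a n + b n) = toP a + toP b"
    unfolding toP_def[of "\<lambda>n. a n + b n"] eq by simp
qed

section \<open>The augmentation\<close>

text \<open>Evaluation at (1,...,1), written as the action on the constant 1 so that
  multiplicativity comes from \<open>act_mult\<close>. An element with \<open>aug p = 0\<close>
  annihilates all constant sequences.\<close>

definition aug :: "('a::ab_group_add \<Rightarrow>\<^sub>0 real) \<Rightarrow> real" where
  "aug p = act p (\<lambda>_. 1) 0"

lemma aug_simps [simp]: "aug 0 = 0" "aug 1 = 1" "aug (single a c) = c"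
  by (simp_all add: aug_def)

lemma aug_add: "aug (p + q) = aug p + aug q"
  by (simp add: aug_def act_add)

lemma aug_mult: "aug (p * q) = aug p * aug q"
proof -
  have eq: "act q (\<lambda>_. 1) = (\<lambda>_. aug q)"
    by (rule ext) (subst act_const, simp add: aug_def)
  have "aug (p * q) = act p (\<lambda>_. aug q) 0"
    unfolding eq[symmetric] by (simp only: aug_def act_mult)
  also have "\<dots> = aug q * aug p"
    by (rule act_const[of p "aug q" 0, folded aug_def])
  finally show ?thesis by (simp only: mult.commute)
qed

lemma aug_eq_sum: "aug p = (\<Sum>k\<in>keys p. lookup p k)"
  by (simp add: aug_def act_def)

text \<open>Translations minus 1 generate the augmentation ideal; estimates on it thereby reduce to
  differences along lattice vectors.\<close>

lemma aug_decompose: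
  assumes "aug h = 0"
  shows "h = (\<Sum>a\<in>keys h. single 0 (lookup h a) * (single a 1 - 1))"
proof -
  have "(\<Sum>a\<in>keys h. single 0 (lookup h a) * (single a 1 - 1))
      = (\<Sum>a\<in>keys h. single a (lookup h a)) - (\<Sum>a\<in>keys h. single 0 (lookup h a))"
    by (simp add: right_diff_distrib mult_single sum_subtractf)
  also have "(\<Sum>a\<in>keys h. single 0 (lookup h a)) = single 0 (\<Sum>a\<in>keys h. lookup h a)"
    by (induction "keys h" rule: infinite_finite_induct)
      (auto simp: single_add[symmetric] intro: poly_mapping_eqI simp: lookup_sum lookup_single when_def)
  finally show ?thesis
    using assms by (simp add: aug_eq_sum pm_decompose[symmetric])
qed

section \<open>The Laplacian and its lazy walk\<close>

lemma lpoly_fd: "lpoly (fd :: int^'d \<Rightarrow> int)"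
proof -
  have "{n::int^'d. fd n \<noteq> 0} \<subseteq> {0} \<union> range (\<lambda>i. axis i 1) \<union> range (\<lambda>i. axis i (-1))"
    by (auto simp: fd_def split: if_splits)
  then show ?thesis
    unfolding lpoly_def by (rule finite_subset) auto
qed

abbreviation lap :: "int^'d \<Rightarrow>\<^sub>0 real" where "lap \<equiv> toP fd"

lemma lap_eq:
  "(lap :: int^'d \<Rightarrow>\<^sub>0 real) = single 0 (2 * real CARD('d))
     - (\<Sum>i\<in>UNIV. single (axis i 1) 1 + single (axis i (-1)) 1)"
proof (rule poly_mapping_eqI)
  fix n :: "int^'d"
  have sum1: "(\<Sum>i\<in>UNIV. (1 when axis i s = n)) = (if \<exists>i. n = axis i s then 1 else (0::real))"
    if s: "s \<noteq> 0" for s :: int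
  proof (cases "\<exists>i. n = axis i s")
    case True
    then obtain i where "n = axis i s" by blast
    then have "(1 when axis j s = n) = (if j = i then 1 else (0::real))" for j
      using s by (auto simp: axis_eq_axis when_def)
    then show ?thesis using True by simp
  qed (auto simp: when_def intro!: sum.neutral)
  have ne: "axis i (1::int) \<noteq> axis j (-1)" for i j :: 'd
    by (simp add: axis_eq_axis)
  have nz: "axis i (1::int) \<noteq> 0" "axis i (-1::int) \<noteq> 0" for i :: 'd
    by (simp_all add: axis_eq_0_iff)
  show "lookup lap n = lookup (single 0 (2 * real CARD('d))
     - (\<Sum>i\<in>UNIV. single (axis i 1) 1 + single (axis i (-1)) 1)) n"
    unfolding lookup_toP[OF lpoly_fd] lookup_minus lookup_sum lookup_add lookup_single sum.distrib
    using ne nz by (subst (1 2) sum1) (auto simp: fd_def when_def)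
qed

lemma act_lap:
  "act lap v (n :: int^'d) = (\<Sum>i\<in>UNIV. 2 * v n - v (n - axis i 1) - v (n + axis i 1))"
proof -
  have [simp]: "n - axis i (-1) = n + axis i 1" for i
    by (vector axis_def)
  show ?thesis
    unfolding lap_eq act_diff act_sum act_add act_single
    by (simp add: sum_subtractf sum.distrib)
qed

text \<open>With 4 d in place of 2 d the walk rests with probability 1/2 and takes each of the 2 d
  unit steps with probability 1/(4 d).\<close>

definition walk :: "int^'d \<Rightarrow>\<^sub>0 real" where
  "walk = 1 - single 0 (1 / (4 * real CARD('d))) * lap"

lemma aug_lap: "aug (lap :: int^'d \<Rightarrow>\<^sub>0 real) = 0"
  by (simp add: aug_def act_lap)

lemma aug_walk: "aug walk = 1"
proof -
  have "aug (single 0 c * lap :: int^'d \<Rightarrow>\<^sub>0 real) = 0" for c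
    by (simp add: aug_mult aug_lap)
  then show ?thesis
    unfolding aug_def walk_def act_diff by simp
qed

lemma aug_power: "aug (p ^ n) = aug p ^ n"
  by (induction n) (auto simp: aug_mult)

text \<open>The step along \<open>axis i 1\<close> has mass 1/(4 d). Paired with an equal part of
  the resting mass 1/2 it forms the component q (1 + U)/2 with q = 1/(2 d); the nonnegative rest has
  total mass 1 - q.\<close>

lemma l1_walk_axis:
  "l1 (walk - single 0 (1 / (2 * real CARD('d)) / 2) * (1 + single (axis i 1 :: int^'d) 1))
     \<le> 1 - 1 / (2 * real CARD('d))"
proof -
  define c where "c = 1 / (4 * real CARD('d))"
  let ?U = "\<lambda>j. single (axis j 1 :: int^'d) c" and ?V = "\<lambda>j. single (axis j (-1) :: int^'d) c"
  have c: "c > 0" by (simp add: c_def)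
  have cd: "c * (2 * real CARD('d)) = 1/2" by (simp add: c_def)
  have "single 0 (1/2) + single 0 (1/2) = (1 :: int^'d \<Rightarrow>\<^sub>0 real)"
    by (simp add: single_add[symmetric])
  then have half: "1 - single 0 (1/2) = (single 0 (1/2) :: int^'d \<Rightarrow>\<^sub>0 real)"
    by (simp add: algebra_simps)
  have "walk = 1 - (single 0 (1/2) - (\<Sum>j\<in>UNIV. ?U j + ?V j))"
    unfolding walk_def lap_eq c_def[symmetric]
    by (simp add: right_diff_distrib mult_single sum_distrib_left distrib_left cd)
  also have "\<dots> = single 0 (1/2) + (\<Sum>j\<in>UNIV. ?U j + ?V j)"
  proof -
    have "1 - (x - y) = (1 - x) + y" for x y :: "int^'d \<Rightarrow>\<^sub>0 real" by simp
    then show ?thesis by (simp only: half)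
  qed
  also have "\<dots> = single 0 (1/2) + ((\<Sum>j\<in>UNIV - {i}. ?U j + ?V j) + (?U i + ?V i))"
    by (subst sum.remove[of _ i]) (auto simp: add_ac)
  finally have "walk - single 0 c * (1 + single (axis i 1 :: int^'d) 1)
     = single 0 (1/2 - c) + ((\<Sum>j\<in>UNIV - {i}. ?U j + ?V j) + ?V i)"
    by (simp add: distrib_left mult_single single_diff algebra_simps)
  also have "l1 \<dots> \<le> (1/2 - c) + ((\<Sum>j\<in>UNIV - {i}. 2 * c) + c)"
  proof (intro order.trans[OF l1_add] add_mono order.trans[OF l1_sum] sum_mono)
    have "c \<le> 1/4" using one_le_card_finite[where 'a='d] by (simp add: c_def field_simps)
    then show "l1 (single (0::int^'d) (1/2 - c)) \<le> 1/2 - c" by simp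
    show "l1 (?V i) \<le> c" using c by simp
    show "l1 (?U j) + l1 (?V j) \<le> 2 * c" for j
      using c by simp
  qed
  also have "\<dots> = 1/2 + c * (2 * real CARD('d)) - 2 * c"
  proof -
    have "real (card (UNIV - {i})) = real CARD('d) - 1"
      using zero_less_card_finite[where 'a='d] by (simp add: card_Diff_singleton of_nat_diff)
    then have "(\<Sum>j\<in>UNIV - {i}. 2 * c) = (real CARD('d) - 1) * (2 * c)"
      by (simp only: sum_constant)
    then show ?thesis by (simp add: algebra_simps)
  qed
  also have "\<dots> = 1 - 1 / (2 * real CARD('d))"
    unfolding cd by (simp add: c_def)
  finally show ?thesis by (simp add: c_def)
qed

lemma l1_walk: "l1 (walk :: int^'d \<Rightarrow>\<^sub>0 real) \<le> 1"
proof -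
  define q where "q = 1 / (2 * real CARD('d))"
  define i :: 'd where "i = undefined"
  let ?S = "single 0 (q / 2) * (1 + single (axis i 1 :: int^'d) 1)"
  have q: "q > 0" by (simp add: q_def)
  have "l1 ?S \<le> \<bar>q / 2\<bar> * (1 + 1)"
    by (rule order.trans[OF l1_single_mult mult_left_mono[OF order.trans[OF l1_add]]]) auto
  moreover have "l1 (walk - ?S) \<le> 1 - q" unfolding q_def by (rule l1_walk_axis)
  moreover have "l1 ((walk - ?S) + ?S) \<le> l1 (walk - ?S) + l1 ?S" by (rule l1_add)
  ultimately show ?thesis using q by simp
qed

section \<open>Decay of differences under the walk\<close>

text \<open>The elements with this property form an ideal, so it has to be checked only for unit
  translations. \<open>Suc N\<close> avoids division by zero at N = 0.\<close>

definition walk_rate :: "(int^'d \<Rightarrow>\<^sub>0 real) \<Rightarrow> bool" where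
  "walk_rate h \<longleftrightarrow> (\<exists>C\<ge>0. \<forall>N. l1 (h * walk ^ N) \<le> C / sqrt (Suc N))"

lemma walk_rate_add:
  assumes "walk_rate g" "walk_rate h" shows "walk_rate (g + h)"
proof -
  from assms obtain C D where "C \<ge> 0" "D \<ge> 0" and
    CD: "\<And>N. l1 (g * walk ^ N) \<le> C / sqrt (Suc N)" "\<And>N. l1 (h * walk ^ N) \<le> D / sqrt (Suc N)"
    by (auto simp: walk_rate_def)
  moreover have "l1 ((g + h) * walk ^ N) \<le> (C + D) / sqrt (Suc N)" for N
    unfolding distrib_right add_divide_distrib
    by (intro order.trans[OF l1_add] add_mono CD)
  ultimately show ?thesis unfolding walk_rate_def by (intro exI[of _ "C + D"]) auto
qed

lemma walk_rate_mult:
  assumes "walk_rate h" shows "walk_rate (r * h)"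
proof -
  from assms obtain C where "C \<ge> 0" and C: "\<And>N. l1 (h * walk ^ N) \<le> C / sqrt (Suc N)"
    by (auto simp: walk_rate_def)
  moreover have "l1 ((r * h) * walk ^ N) \<le> (l1 r * C) / sqrt (Suc N)" for N
    unfolding mult.assoc times_divide_eq_right[symmetric]
    by (intro order.trans[OF l1_mult] mult_left_mono C l1_nonneg)
  ultimately show ?thesis unfolding walk_rate_def
    by (intro exI[of _ "l1 r * C"]) (auto simp: l1_nonneg)
qed

lemma walk_rate_sum: "(\<And>i. i \<in> I \<Longrightarrow> walk_rate (h i)) \<Longrightarrow> walk_rate (sum h I)"
proof (induction I rule: infinite_finite_induct)
  case empty
  then show ?case by (auto simp: walk_rate_def intro: exI[of _ 0])
next
  case (infinite A)
  then show ?case by (auto simp: walk_rate_def intro: exI[of _ 0])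
qed (auto intro: walk_rate_add)

lemma walk_rate_axis: "walk_rate (single (axis i 1) 1 - 1 :: int^'d \<Rightarrow>\<^sub>0 real)"
proof -
  define q where "q = 1 / (2 * real CARD('d))"
  have "2 * real CARD('d) \<ge> 1"
    using real_of_nat_ge_one_iff[of "CARD('d)"] zero_less_card_finite[where 'a='d] by linarith
  then have q: "0 < q" "q \<le> 1" unfolding q_def by (simp, subst divide_le_eq_1_pos) auto
  have "l1 ((single (axis i 1) 1 - 1) * (walk :: int^'d \<Rightarrow>\<^sub>0 real) ^ N) \<le> (2 / sqrt q) / sqrt (Suc N)" for N
  proof -
    have "l1 ((single (axis i 1) 1 - 1) * (walk :: int^'d \<Rightarrow>\<^sub>0 real) ^ N) \<le> 2 / sqrt (q * Suc N)"
      using q l1_walk_axis[of i] unfolding q_def[symmetric] by (rule l1_lazy_walk_difference)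
    then show ?thesis by (simp add: real_sqrt_mult)
  qed
  then show ?thesis using q unfolding walk_rate_def by (intro exI[of _ "2 / sqrt q"]) auto
qed

lemma vec_sum_axis: "(\<Sum>i\<in>UNIV. axis i (n $ i)) = (n :: int^'d)"
  by (simp add: vec_eq_iff axis_def sum.delta)

text \<open>An induction principle for lattice vectors: a property stable under sums and negation
  need only be checked on unit vectors. It serves both the walk and the characters.\<close>

lemma subgroup_UNIV:
  fixes A :: "(int^'d) set"
  assumes "0 \<in> A" "\<And>a b. a \<in> A \<Longrightarrow> b \<in> A \<Longrightarrow> a + b \<in> A" "\<And>a. a \<in> A \<Longrightarrow> - a \<in> A"
    and ax: "\<And>i. axis i 1 \<in> A"
  shows "A = UNIV"
proof -
  have m: "axis i m \<in> A" for i m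
  proof (induction m rule: int_induct[where k=0])
    case base
    have "axis i (0::int) = 0" by (simp only: axis_eq_0_iff)
    then show ?case using assms(1) by (simp only:)
  next
    case (step1 m)
    have "axis i (m + 1) = axis i m + axis i 1" by (vector axis_def)
    with step1 assms(2) ax show ?case by simp
  next
    case (step2 m)
    have "axis i (m - 1) = axis i m + - axis i 1" by (vector axis_def)
    with step2 assms(2)[OF step2(2) assms(3)[OF ax[of i]]] show ?case by simp
  qed
  have "n \<in> A" for n
  proof -
    have "(\<Sum>i\<in>S. axis i (n $ i)) \<in> A" for S
      by (induction S rule: infinite_finite_induct) (auto intro: assms m)
    from this[of UNIV] show ?thesis
      by (simp only: vec_sum_axis)
  qed
  then show ?thesis by auto
qed

lemma walk_rate_translation: "walk_rate (single a 1 - 1 :: int^'d \<Rightarrow>\<^sub>0 real)"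
proof -
  have "{a. walk_rate (single a 1 - 1 :: int^'d \<Rightarrow>\<^sub>0 real)} = UNIV"
  proof (rule subgroup_UNIV, goal_cases)
    case 1
    then show ?case by (auto simp: walk_rate_def intro: exI[of _ 0])
  next
    case (2 a b)
    have eq: "single (a + b) 1 - 1 = single a 1 * (single b 1 - 1) + (single a 1 - 1 :: int^'d \<Rightarrow>\<^sub>0 real)"
      by (simp add: right_diff_distrib mult_single)
    show ?case unfolding mem_Collect_eq eq using 2 by (auto intro: walk_rate_add walk_rate_mult)
  next
    case (3 a)
    have "single (- a) 1 - 1 = single (- a) (-1) * (single a 1 - 1 :: int^'d \<Rightarrow>\<^sub>0 real)"
      by (simp add: right_diff_distrib mult_single single_uminus single_one[symmetric] del: single_one)
    with 3 show ?case by (auto intro: walk_rate_mult)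
  qed (auto intro: walk_rate_axis)
  then show ?thesis by auto
qed

lemma walk_rate_aug: "aug h = 0 \<Longrightarrow> walk_rate h"
  by (subst aug_decompose, assumption) (intro walk_rate_sum walk_rate_mult walk_rate_translation)

lemma summable_l1_walk_triple:
  fixes h1 h2 h3 r :: "int^'d \<Rightarrow>\<^sub>0 real"
  assumes "aug h1 = 0" "aug h2 = 0" "aug h3 = 0"
  shows "summable (\<lambda>M. l1 (r * (h1 * h2 * h3) * walk ^ M))"
proof -
  from assms obtain C1 C2 C3 where nn: "C1 \<ge> 0" "C2 \<ge> 0" "C3 \<ge> 0" and
    C: "\<And>N. l1 (h1 * walk ^ N) \<le> C1 / sqrt (Suc N)" "\<And>N. l1 (h2 * walk ^ N) \<le> C2 / sqrt (Suc N)"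
       "\<And>N. l1 (h3 * walk ^ N) \<le> C3 / sqrt (Suc N)"
    using walk_rate_aug by (metis (no_types) walk_rate_def)
  define K where "K = l1 r * C1 * C2 * C3 * 3 powr (3/2)"
  have bound: "l1 (r * (h1 * h2 * h3) * walk ^ M) \<le> K * (real (Suc M) powr (- 3/2))" for M
  proof -
    \<comment> \<open>Each of the three difference factors receives a third of the steps; the M mod
      3 steps left over have norm at most 1.\<close>
    define N where "N = M div 3"
    have M: "M = N + N + N + M mod 3" unfolding N_def by presburger
    have "r * (h1 * h2 * h3) * walk ^ M
        = (r * walk ^ (M mod 3)) * ((h1 * walk ^ N) * ((h2 * walk ^ N) * (h3 * walk ^ N)))"
      by (subst M) (simp only: power_add mult_ac)
    also have "l1 \<dots> \<le> (l1 r * 1) * ((C1 / sqrt (Suc N)) * ((C2 / sqrt (Suc N)) * (C3 / sqrt (Suc N))))"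
      by (rule order.trans[OF l1_mult] mult_mono mult_left_mono C l1_power_le_one l1_walk l1_nonneg
          mult_nonneg_nonneg divide_nonneg_nonneg nn zero_le_one real_sqrt_ge_zero of_nat_0_le_iff)+
    also have "\<dots> = l1 r * C1 * C2 * C3 * (real (Suc N) powr (- 3/2))"
    proof -
      have "sqrt (Suc N) * sqrt (Suc N) * sqrt (Suc N) = real (Suc N) powr (3/2)"
        using powr_add[of "real (Suc N)" "1/2 + 1/2" "1/2"] powr_add[of "real (Suc N)" "1/2" "1/2"]
        by (simp add: powr_half_sqrt)
      then have "real (Suc N) powr (- 3/2) = 1 / (sqrt (Suc N) * sqrt (Suc N) * sqrt (Suc N))"
        using powr_minus_divide[of "real (Suc N)" "3/2"] by simp
      moreover have "a * 1 * (b / t * (c / t * (d / t))) = a * b * c * d * (1 / (t * t * t))"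
        for a b c d t :: real by simp
      ultimately show ?thesis by (simp only:)
    qed
    \<comment> \<open>From M <= 3 N + 2 follows Suc M <= 3 (Suc N); this is the origin of
      \<open>3 powr (3/2)\<close> in \<open>K\<close>.\<close>
    also have "\<dots> \<le> l1 r * C1 * C2 * C3 * ((real (Suc M) / 3) powr (- 3/2))"
      using nn by (intro mult_left_mono powr_mono2') (auto simp: N_def l1_nonneg)
    also have "(real (Suc M) / 3) powr (- 3/2) = 3 powr (3/2) * real (Suc M) powr (- 3/2)"
      by (simp add: powr_divide powr_minus field_simps)
    finally show ?thesis by (simp only: K_def mult.assoc)
  qed
  have "summable (\<lambda>M. real (Suc M) powr (- 3/2))"
    using summable_Suc_iff[of "\<lambda>n. real n powr (- 3/2)"] by (simp add: summable_real_powr_iff)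
  then have "summable (\<lambda>M. K * (real (Suc M) powr (- 3/2)))" by (rule summable_mult)
  then show ?thesis
    by (rule summable_comparison_test'[where N=0]) (use bound in \<open>auto simp: l1_nonneg\<close>)
qed

section \<open>Sequences with integral third differences\<close>

lemma Ints_weighted_sum:
  fixes g :: "'b \<Rightarrow> int"
  assumes "\<And>k. k \<in> S \<Longrightarrow> x k - z k \<in> \<int>" "(\<Sum>k\<in>S. real_of_int (g k) * z k) \<in> \<int>"
  shows "(\<Sum>k\<in>S. real_of_int (g k) * x k) \<in> \<int>"
proof -
  have "(\<Sum>k\<in>S. real_of_int (g k) * x k)
      = (\<Sum>k\<in>S. real_of_int (g k) * (x k - z k)) + (\<Sum>k\<in>S. real_of_int (g k) * z k)"
    by (simp add: sum.distrib[symmetric] algebra_simps)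
  then show ?thesis using assms by (auto intro!: Ints_add Ints_mult Ints_sum)
qed

text \<open>Modulo 1, such a \<open>y\<close> is a quadratic polynomial; \<open>\<beta>\<close> below is its polar form.\<close>

lemma third_differences_Ints_imp_sum_Ints:
  fixes y :: "int^'d \<Rightarrow> real" and g :: "int^'d \<Rightarrow> int"
  assumes T3: "\<And>a b c. y (a + b + c) - y (a + b) - y (a + c) - y (b + c) + y a + y b + y c - y 0 \<in> \<int>"
    and m0: "(\<Sum>k\<in>S. real_of_int (g k)) = 0"
    and m1: "\<And>i. (\<Sum>k\<in>S. real_of_int (g k) * real_of_int (k $ i)) = 0"
    and m2: "\<And>i j. (\<Sum>k\<in>S. real_of_int (g k) * (real_of_int (k $ i) * real_of_int (k $ j))) = 0"
  shows "(\<Sum>k\<in>S. real_of_int (g k) * y k) \<in> \<int>"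
proof -
  define \<beta> where "\<beta> a b = y (a + b) - y a - y b + y 0" for a b
  define e :: "'d \<Rightarrow> int^'d" where "e i = axis i 1" for i
  have ax0: "axis i (0::int) = 0" for i by (simp only: axis_eq_0_iff)
  have ax1: "axis i (m + 1) = axis i m + e i" "axis i (m - 1) + e i = axis i m" for i m
    unfolding e_def by (vector axis_def)+
  \<comment> \<open>Integrality of third differences is additivity of the polar form modulo 1, in
    either argument by symmetry.\<close>
  have \<beta>_add: "\<beta> (a + a') b - (\<beta> a b + \<beta> a' b) \<in> \<int>" for a a' b
    using T3[of a a' b] by (simp add: \<beta>_def algebra_simps)
  have \<beta>_0: "\<beta> 0 b = 0" for b by (simp add: \<beta>_def)
  have \<beta>_commute: "\<beta> a b = \<beta> b a" for a b by (simp add: \<beta>_def add.commute)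
  have \<beta>_axis: "\<beta> (axis i m) b - real_of_int m * \<beta> (e i) b \<in> \<int>" for i m b
  proof (induction m rule: int_induct[where k=0])
    case base
    then show ?case by (simp add: ax0 \<beta>_0)
  next
    case (step1 m)
    have "\<beta> (axis i (m + 1)) b - (\<beta> (axis i m) b + \<beta> (e i) b) \<in> \<int>"
      unfolding ax1 by (rule \<beta>_add)
    from Ints_add[OF this step1(2)] show ?case by (simp add: algebra_simps)
  next
    case (step2 m)
    have "\<beta> (axis i m) b - (\<beta> (axis i (m - 1)) b + \<beta> (e i) b) \<in> \<int>"
      using \<beta>_add[of "axis i (m - 1)" "e i" b] by (simp only: ax1)
    from Ints_diff[OF step2(2) this] show ?case by (simp add: algebra_simps)
  qed
  \<comment> \<open>Newton's formula along one axis modulo 1: the second difference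
    \<open>\<beta> (e i) (e i)\<close> enters with the coefficient m (m - 1)/2, for negative m as
    well.\<close>
  have y_axis: "y (axis i m) - y 0
      - (real_of_int m * (y (e i) - y 0) + (real_of_int m * real_of_int m - real_of_int m) / 2 * \<beta> (e i) (e i)) \<in> \<int>"
    for i m
  proof (induction m rule: int_induct[where k=0])
    case base
    then show ?case by (simp add: ax0)
  next
    case (step1 m)
    have "y (axis i (m + 1)) = y (axis i m) + y (e i) - y 0 + \<beta> (axis i m) (e i)"
      by (simp add: \<beta>_def ax1)
    then have eq: "y (axis i (m + 1)) - y 0 - (of_int (m + 1) * (y (e i) - y 0)
        + (of_int (m + 1) * of_int (m + 1) - of_int (m + 1)) / 2 * \<beta> (e i) (e i))
      = (y (axis i m) - y 0 - (of_int m * (y (e i) - y 0) + (of_int m * of_int m - of_int m) / 2 * \<beta> (e i) (e i)))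
        + (\<beta> (axis i m) (e i) - of_int m * \<beta> (e i) (e i))"
      by (simp only:) (simp add: field_simps)
    show ?case unfolding eq by (intro Ints_add step1 \<beta>_axis)
  next
    case (step2 m)
    have "y (axis i m) = y (axis i (m - 1)) + y (e i) - y 0 + \<beta> (axis i (m - 1)) (e i)"
      by (simp add: \<beta>_def ax1)
    then have eq: "y (axis i (m - 1)) - y 0 - (of_int (m - 1) * (y (e i) - y 0)
        + (of_int (m - 1) * of_int (m - 1) - of_int (m - 1)) / 2 * \<beta> (e i) (e i))
      = (y (axis i m) - y 0 - (of_int m * (y (e i) - y 0) + (of_int m * of_int m - of_int m) / 2 * \<beta> (e i) (e i)))
        - (\<beta> (axis i (m - 1)) (e i) - of_int (m - 1) * \<beta> (e i) (e i))"
      by (simp only:) (simp add: field_simps)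
    show ?case unfolding eq by (intro Ints_diff step2 \<beta>_axis)
  qed
  \<comment> \<open>Lattice points are assembled one coordinate at a time; \<open>T\<close> is the
    set of coordinates already present.\<close>
  define pr where "pr T n = (\<Sum>i\<in>T. axis i (n $ i))" for T and n :: "int^'d"
  have \<beta>_pr: "\<beta> (pr T n) b - (\<Sum>i\<in>T. real_of_int (n $ i) * \<beta> (e i) b) \<in> \<int>" for T n b
  proof (induction T rule: infinite_finite_induct)
    case (insert i T)
    have "\<beta> (pr (insert i T) n) b - (\<beta> (axis i (n $ i)) b + \<beta> (pr T n) b) \<in> \<int>"
      using insert \<beta>_add by (simp add: pr_def)
    from Ints_add[OF this Ints_add[OF insert(3) \<beta>_axis[of i "n $ i" b]]] show ?case
      using insert by (simp add: algebra_simps)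
  qed (auto simp: pr_def \<beta>_0)
  have "(\<Sum>k\<in>S. real_of_int (g k) * (y (pr T k) - y 0)) \<in> \<int>" for T
  proof (induction T rule: infinite_finite_induct)
    case (insert i T)
    have 1: "(\<Sum>k\<in>S. real_of_int (g k) * (y (axis i (k $ i)) - y 0)) \<in> \<int>"
    proof (rule Ints_weighted_sum[OF y_axis])
      have "(\<Sum>k\<in>S. real_of_int (g k) * (real_of_int (k $ i) * c
          + (real_of_int (k $ i) * real_of_int (k $ i) - real_of_int (k $ i)) / 2 * d))
        = c * (\<Sum>k\<in>S. real_of_int (g k) * real_of_int (k $ i))
          + d / 2 * ((\<Sum>k\<in>S. real_of_int (g k) * (real_of_int (k $ i) * real_of_int (k $ i)))
             - (\<Sum>k\<in>S. real_of_int (g k) * real_of_int (k $ i)))" for c d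
        unfolding sum_distrib_left sum_subtractf[symmetric] sum.distrib[symmetric]
        by (intro sum.cong) (auto simp: field_simps)
      then show "(\<Sum>k\<in>S. real_of_int (g k) * (real_of_int (k $ i) * (y (e i) - y 0)
          + (real_of_int (k $ i) * real_of_int (k $ i) - real_of_int (k $ i)) / 2 * \<beta> (e i) (e i))) \<in> \<int>"
        by (simp add: m1 m2)
    qed
    \<comment> \<open>Modulo integers the cross terms expand into multiples of k_i k_j with j in
      \<open>T\<close>, whose weighted sums vanish by \<open>m2\<close>.\<close>
    have 2: "(\<Sum>k\<in>S. real_of_int (g k) * \<beta> (pr T k) (axis i (k $ i))) \<in> \<int>"
    proof (rule Ints_weighted_sum)
      fix k
      have "\<beta> (axis i (k $ i)) (pr T k) - real_of_int (k $ i) * \<beta> (e i) (pr T k) \<in> \<int>"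
        by (rule \<beta>_axis)
      moreover have "real_of_int (k $ i) * (\<beta> (pr T k) (e i) - (\<Sum>j\<in>T. real_of_int (k $ j) * \<beta> (e j) (e i))) \<in> \<int>"
        by (intro Ints_mult \<beta>_pr) auto
      ultimately show "\<beta> (pr T k) (axis i (k $ i))
          - real_of_int (k $ i) * (\<Sum>j\<in>T. real_of_int (k $ j) * \<beta> (e j) (e i)) \<in> \<int>"
        using Ints_add by (fastforce simp: \<beta>_commute algebra_simps)
    next
      have "(\<Sum>k\<in>S. real_of_int (g k) * (real_of_int (k $ i) * (\<Sum>j\<in>T. real_of_int (k $ j) * \<beta> (e j) (e i))))
        = (\<Sum>j\<in>T. \<beta> (e j) (e i) * (\<Sum>k\<in>S. real_of_int (g k) * (real_of_int (k $ i) * real_of_int (k $ j))))"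
        unfolding sum_distrib_left by (subst sum.swap) (simp add: mult_ac)
      then show "(\<Sum>k\<in>S. real_of_int (g k) * (real_of_int (k $ i) * (\<Sum>j\<in>T. real_of_int (k $ j) * \<beta> (e j) (e i)))) \<in> \<int>"
        by (simp add: m2)
    qed
    have "y (pr (insert i T) k) - y 0
        = (y (pr T k) - y 0) + ((y (axis i (k $ i)) - y 0) + \<beta> (pr T k) (axis i (k $ i)))" for k
      using insert by (simp add: pr_def \<beta>_def add.commute)
    then have "(\<Sum>k\<in>S. real_of_int (g k) * (y (pr (insert i T) k) - y 0))
       = (\<Sum>k\<in>S. real_of_int (g k) * (y (pr T k) - y 0))
        + ((\<Sum>k\<in>S. real_of_int (g k) * (y (axis i (k $ i)) - y 0))
        + (\<Sum>k\<in>S. real_of_int (g k) * \<beta> (pr T k) (axis i (k $ i))))"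
      by (simp only: distrib_left sum.distrib)
    then show ?case using insert(3) 1 2 by (simp only: Ints_add)
  qed (auto simp: pr_def)
  from this[of UNIV] have "(\<Sum>k\<in>S. real_of_int (g k) * (y k - y 0)) \<in> \<int>"
    by (simp only: pr_def vec_sum_axis)
  moreover have "(\<Sum>k\<in>S. real_of_int (g k) * (y k - y 0)) = (\<Sum>k\<in>S. real_of_int (g k) * y k) - (\<Sum>k\<in>S. real_of_int (g k)) * y 0"
    by (simp add: right_diff_distrib sum_subtractf sum_distrib_right)
  ultimately show ?thesis using m0 by simp
qed

section \<open>Summable solutions of the Poisson equation\<close>

text \<open>Integrability for the counting measure gives access to dominated convergence and
  termwise integration; the next lemma links it to \<open>summable_on\<close>.\<close>

definition ell1 :: "('a \<Rightarrow> real) \<Rightarrow> bool" where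
  "ell1 a \<longleftrightarrow> integrable (count_space UNIV) a"

lemma ell1_iff_summable: "ell1 a \<longleftrightarrow> (\<lambda>n. \<bar>a n\<bar>) summable_on UNIV"
  using abs_summable_equivalent[of a UNIV] by (simp add: ell1_def abs_summable_on_def)

lemma infsum_eq_integral: "ell1 a \<Longrightarrow> infsum a UNIV = integral\<^sup>L (count_space UNIV) a"
  using infsetsum_infsum[of a UNIV] by (simp add: ell1_def abs_summable_on_def infsetsum_def)

lemma ell1_reindex:
  fixes a :: "'a \<Rightarrow> real"
  assumes "bij f"
  shows "ell1 (\<lambda>n. a (f n)) \<longleftrightarrow> ell1 a"
  unfolding ell1_iff_summable using assms by (rule summable_on_reindex_bij_betw)

lemma ell1_bound:
  assumes "ell1 a" "\<And>n. \<bar>b n\<bar> \<le> B * \<bar>a n\<bar>"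
  shows "ell1 b"
proof -
  have bound: "\<bar>b n\<bar> \<le> \<bar>B\<bar> * \<bar>a n\<bar>" for n
    using assms(2)[of n] mult_right_mono[OF abs_ge_self[of B] abs_ge_zero[of "a n"]] by linarith
  show ?thesis unfolding ell1_def
  proof (rule Bochner_Integration.integrable_bound[of _ "\<lambda>n. B * a n"])
    show "integrable (count_space UNIV) (\<lambda>n. B * a n)"
      using assms(1) by (simp add: ell1_def)
    show "AE n in count_space UNIV. norm (b n) \<le> norm (B * a n)"
      by (rule AE_I2) (simp only: real_norm_def abs_mult bound)
  qed simp
qed

lemma ell1_mult_bounded:
  assumes "ell1 a" "\<And>n. \<bar>v n\<bar> \<le> B"
  shows "ell1 (\<lambda>n. a n * v n)"
proof (rule ell1_bound[OF assms(1)])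
  fix n
  show "\<bar>a n * v n\<bar> \<le> B * \<bar>a n\<bar>"
    using mult_right_mono[OF assms(2)[of n] abs_ge_zero[of "a n"]] by (simp only: abs_mult mult.commute)
qed

lemma bij_translate: "bij (\<lambda>n. n - a)" "bij (\<lambda>n. n + a)" for a :: "'a::ab_group_add"
proof -
  show "bij (\<lambda>n. n - a)" by (rule bij_betwI[where g="\<lambda>n. n + a"]) auto
  show "bij (\<lambda>n. n + a)" by (rule bij_betwI[where g="\<lambda>n. n - a"]) auto
qed

lemma ell1_act:
  assumes "ell1 a" shows "ell1 (act p a)"
proof (induction p rule: pm_induct)
  case (single b c)
  have "ell1 (\<lambda>n. a (n - b))" using assms ell1_reindex[OF bij_translate(1)] by blast
  then show ?case by (simp add: ell1_def)
qed (auto simp: ell1_def act_add)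

lemma conv_eq_integral:
  assumes "ell1 a" "\<And>n. \<bar>v n\<bar> \<le> B"
  shows "conv a v n = (LINT k|count_space UNIV. a k * v (n - k))"
  unfolding conv_def by (intro infsum_eq_integral ell1_mult_bounded) (use assms in auto)

lemma conv_integrable:
  assumes "ell1 a" "\<And>n. \<bar>v n\<bar> \<le> B"
  shows "integrable (count_space UNIV) (\<lambda>k. a k * v (n - k))"
  unfolding ell1_def[symmetric] by (intro ell1_mult_bounded) (use assms in auto)

text \<open>Together with \<open>conv_act_left\<close> this moves an operator from one factor of a
  convolution to the other.\<close>

lemma conv_act_right:
  assumes "ell1 a" "\<And>n. \<bar>v n\<bar> \<le> B"
  shows "conv a (act p v) n = act p (conv a v) n"
proof -
  have "\<bar>act p v n\<bar> \<le> l1 p * B" for p n using assms(2) by (rule act_bound)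
  note eq = conv_eq_integral[OF assms(1) this]
  show ?thesis unfolding eq
  proof (induction p arbitrary: n rule: pm_induct)
    case (single b c)
    have "n - k - b = n - b - k" for k by (simp add: algebra_simps)
    then show ?case by (simp only: act_single conv_eq_integral[OF assms] mult.left_commute[of _ c]
        Bochner_Integration.integral_mult_right_zero)
  next
    case (add p q)
    have "integrable (count_space UNIV) (\<lambda>k. a k * act p v (n - k))" for p
      by (intro conv_integrable[where B="l1 p * B"] assms(1) act_bound) (rule assms(2))
    then show ?case using add by (simp add: act_add distrib_left)
  qed simp
qed

lemma conv_act_left:
  assumes "ell1 a" "\<And>n. \<bar>v n\<bar> \<le> B"
  shows "conv (act p a) v n = act p (conv a v) n"
proof -
  note eq = conv_eq_integral[OF ell1_act[OF assms(1)] assms(2)]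
  show ?thesis unfolding eq
  proof (induction p arbitrary: n rule: pm_induct)
    case (single b c)
    have "(LINT k|count_space UNIV. act (single b c) a k * v (n - k))
        = c * (LINT k|count_space UNIV. a (k - b) * v (n - k))"
      by (simp add: mult.assoc)
    also have "(LINT k|count_space UNIV. a (k - b) * v (n - k)) = (LINT k|count_space UNIV. a k * v (n - (k + b)))"
      using integral_bij_count_space[OF bij_translate(2)[of b], of "\<lambda>k. a (k - b) * v (n - k)"] by simp
    also have "\<dots> = conv a v (n - b)"
      unfolding conv_eq_integral[OF assms] by (simp add: algebra_simps)
    finally show ?case by simp
  next
    case (add p q)
    have "integrable (count_space UNIV) (\<lambda>k. act p a k * v (n - k))" for p
      by (intro conv_integrable[where B=B] ell1_act assms)
    then show ?case using add by (simp add: act_add distrib_right)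
  qed simp
qed

lemma conv_const: "ell1 a \<Longrightarrow> conv a (\<lambda>_. c) n = c * infsum a UNIV"
  unfolding conv_def infsum_cmult_left' by (rule mult.commute)

section \<open>Moments of the symbol at the trivial character\<close>

lemma ipr_minus [simp]: "ipr (- n) x = - ipr n x"
  and ipr_zero [simp]: "ipr 0 x = 0"
  and ipr_scaleR [simp]: "ipr n (s *\<^sub>R x) = s * ipr n x"
  and ipr_add: "ipr (n + k) x = ipr n x + ipr k x"
  and ipr_diff: "ipr (n - k) x = ipr n x - ipr k x"
  by (simp_all add: ipr_def distrib_right left_diff_distrib sum.distrib sum_subtractf sum_negf
      sum_distrib_left mult.left_commute)

lemma ipr_axis [simp]: "ipr (axis i 1) x = x $ i"
proof -
  have "ipr (axis i 1) x = (\<Sum>j\<in>UNIV. if j = i then x $ j else 0)"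
    unfolding ipr_def by (intro sum.cong) (auto simp: axis_def)
  then show ?thesis by simp
qed

text \<open>Shifted cosines are eigenfunctions of the Laplacian; the phase pi/2 later produces the
  sines that detect first moments.\<close>

lemma act_lap_cos:
  "act lap (\<lambda>k. cos (ipr k x + \<phi>)) n = (\<Sum>i\<in>UNIV. 2 - 2 * cos (x $ i)) * cos (ipr n x + \<phi>)"
proof -
  have "2 * cos (ipr n x + \<phi>) - cos (ipr (n - axis i 1) x + \<phi>) - cos (ipr (n + axis i 1) x + \<phi>)
      = (2 - 2 * cos (x $ i)) * cos (ipr n x + \<phi>)" for i
  proof -
    have 1: "ipr (n + axis i 1) x + \<phi> = (ipr n x + \<phi>) + x $ i" "ipr (n - axis i 1) x + \<phi> = (ipr n x + \<phi>) - x $ i"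
      by (simp_all add: ipr_add ipr_diff)
    show ?thesis unfolding 1 cos_add cos_diff by (simp add: algebra_simps)
  qed
  then show ?thesis by (simp add: act_lap sum_distrib_right)
qed

lemma cos_quadratic_tendsto: "((\<lambda>s. (cos (s * b) - 1) / s\<^sup>2) \<longlongrightarrow> - (b\<^sup>2 / 2)) (at_right (0::real))"
proof (cases "b = 0")
  case False
  then consider "b > 0" | "b < 0" by linarith
  then show ?thesis by cases (real_asymp simp: field_simps power2_eq_square)+
qed simp

lemma sin_linear_tendsto: "((\<lambda>s. sin (s * b) / s) \<longlongrightarrow> b) (at_right (0::real))"
proof (cases "b = 0")
  case False
  then consider "b > 0" | "b < 0" by linarith
  then show ?thesis by cases (real_asymp simp: field_simps power2_eq_square)+
qed simp

text \<open>Testing \<open>f a = g\<close> against \<open>cos (s \<langle>k, x\<rangle>)\<close> and \<open>sin (s \<langle>k, x\<rangle>)\<close> and letting \<open>s\<close> tend to 0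
  replaces the missing second moments of the summable sequence \<open>a\<close>.\<close>

lemma
  fixes g :: "int^'d \<Rightarrow> int" and a :: "int^'d \<Rightarrow> real"
  assumes g: "lpoly g" and a: "ell1 a" and eq: "act lap a = rseq g"
  defines "S \<equiv> {k. g k \<noteq> 0}"
  shows directional_moment0: "(\<Sum>k\<in>S. real_of_int (g k)) = 0"
    and directional_moment1: "(\<Sum>k\<in>S. real_of_int (g k) * ipr k x) = 0"
    and directional_moment2: "(\<Sum>k\<in>S. real_of_int (g k) * (ipr k x)\<^sup>2) = - 2 * ((\<Sum>i\<in>UNIV. (x $ i)\<^sup>2) * infsum a UNIV)"
proof -
  define L where "L s = (\<Sum>i\<in>UNIV. 2 - 2 * cos (s * x $ i))" for s
  define I where "I s \<phi> = (LINT k|count_space UNIV. a k * cos (\<phi> - s * ipr k x))" for s \<phi>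
  \<comment> \<open>In Fourier terms: the symbol of g at frequency s x is the symbol
    \<open>L s\<close> of the Laplacian times the transform of a. The convolution with a cosine is
    computed twice, with \<open>lap\<close> on either factor.\<close>
  have key: "(\<Sum>k\<in>S. real_of_int (g k) * cos (\<phi> - s * ipr k x)) = L s * I s \<phi>" for s \<phi>
  proof -
    define c :: "int^'d \<Rightarrow> real" where "c = (\<lambda>k. cos (ipr k (s *\<^sub>R x) + \<phi>))"
    have c: "\<bar>c n\<bar> \<le> 1" for n by (simp add: c_def)
    have actc: "act lap c = (\<lambda>n. L s * c n)"
      by (rule ext) (simp only: c_def act_lap_cos L_def vector_scaleR_component real_scaleR_def)
    have "(\<Sum>k\<in>S. real_of_int (g k) * cos (\<phi> - s * ipr k x)) = act (toP g) c 0"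
      by (simp add: act_toP[OF g] S_def c_def)
    also have "\<dots> = conv (act lap a) c 0" by (simp add: eq conv_rseq[OF g])
    also have "\<dots> = conv a (act lap c) 0"
      by (simp add: conv_act_left[OF a c] conv_act_right[OF a c])
    also have "\<dots> = L s * conv a c 0"
      unfolding actc conv_def by (simp add: mult.left_commute[of _ "L s"] infsum_cmult_right')
    also have "conv a c 0 = I s \<phi>"
      unfolding conv_eq_integral[OF a c] I_def by (simp add: c_def)
    finally show ?thesis .
  qed
  \<comment> \<open>Summability of a makes its transform continuous at 0; division by powers of s is
    left to \<open>L s\<close>, which is of order s^2.\<close>
  have I_lim: "((\<lambda>s. I s \<phi>) \<longlongrightarrow> I 0 \<phi>) (at_right 0)" for \<phi>
    unfolding I_def tendsto_at_iff_sequentially comp_def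
  proof (intro allI impI)
    fix X :: "nat \<Rightarrow> real" assume X: "X \<longlonglongrightarrow> 0"
    have "(\<lambda>i. a k * cos (\<phi> - X i * ipr k x)) \<longlonglongrightarrow> a k * cos (\<phi> - 0 * ipr k x)" for k
      by (intro tendsto_intros X)
    then show "(\<lambda>i. LINT k|count_space UNIV. a k * cos (\<phi> - X i * ipr k x))
        \<longlonglongrightarrow> (LINT k|count_space UNIV. a k * cos (\<phi> - 0 * ipr k x))"
      using a by (intro integral_dominated_convergence[where w="\<lambda>k. \<bar>a k\<bar>"])
        (auto simp: ell1_def abs_mult AE_count_space intro!: mult_left_le)
  qed
  have I0: "I 0 0 = infsum a UNIV" by (simp add: I_def infsum_eq_integral[OF a])
  have L_lim: "((\<lambda>s. L s / s\<^sup>2) \<longlongrightarrow> (\<Sum>i\<in>UNIV. (x $ i)\<^sup>2)) (at_right 0)"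
  proof -
    have "((\<lambda>s. \<Sum>i\<in>UNIV. - 2 * ((cos (s * x $ i) - 1) / s\<^sup>2)) \<longlongrightarrow> (\<Sum>i\<in>UNIV. - 2 * - ((x $ i)\<^sup>2 / 2))) (at_right 0)"
      by (intro tendsto_intros cos_quadratic_tendsto)
    moreover have "(\<Sum>i\<in>UNIV. - 2 * ((cos (s * x $ i) - 1) / s\<^sup>2)) = L s / s\<^sup>2" for s
      unfolding L_def sum_divide_distrib by (intro sum.cong refl) (simp add: diff_divide_distrib)
    ultimately show ?thesis by simp
  qed
  have ev: "eventually (\<lambda>s. s \<noteq> 0) (at_right (0::real))"
    by (simp add: eventually_at_filter)
  have id0: "((\<lambda>s. s) \<longlongrightarrow> 0) (at_right (0::real))" by (rule tendsto_ident_at)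
  have 1: "((\<lambda>s. \<Sum>k\<in>S. real_of_int (g k) * cos (0 - s * ipr k x)) \<longlongrightarrow> (\<Sum>k\<in>S. real_of_int (g k) * cos (0 - 0 * ipr k x))) (at_right 0)"
    by (intro tendsto_intros)
  have 2: "((\<lambda>s. \<Sum>k\<in>S. real_of_int (g k) * cos (0 - s * ipr k x)) \<longlongrightarrow> (\<Sum>i\<in>UNIV. 2 - 2 * cos (0 * x $ i)) * I 0 0) (at_right 0)"
    unfolding key unfolding L_def by (intro tendsto_intros I_lim)
  show m0: "(\<Sum>k\<in>S. real_of_int (g k)) = 0"
    using tendsto_unique[OF trivial_limit_at_right_real 1 2] by simp
  have 3: "((\<lambda>s. \<Sum>k\<in>S. real_of_int (g k) * (sin (s * ipr k x) / s)) \<longlongrightarrow> (\<Sum>k\<in>S. real_of_int (g k) * ipr k x)) (at_right 0)"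
    by (intro tendsto_intros sin_linear_tendsto)
  \<comment> \<open>After division by s a factor s of \<open>L s\<close> is left over, so the limit
    is 0.\<close>
  have 4: "((\<lambda>s. \<Sum>k\<in>S. real_of_int (g k) * (sin (s * ipr k x) / s)) \<longlongrightarrow> (\<Sum>i\<in>UNIV. (x $ i)\<^sup>2) * 0 * I 0 (pi/2)) (at_right 0)"
  proof (rule Lim_transform_eventually)
    show "((\<lambda>s. (L s / s\<^sup>2) * s * I s (pi/2)) \<longlongrightarrow> (\<Sum>i\<in>UNIV. (x $ i)\<^sup>2) * 0 * I 0 (pi/2)) (at_right 0)"
      by (intro tendsto_mult L_lim I_lim id0)
    show "\<forall>\<^sub>F s in at_right 0. (L s / s\<^sup>2) * s * I s (pi/2) = (\<Sum>k\<in>S. real_of_int (g k) * (sin (s * ipr k x) / s))"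
      using ev
    proof eventually_elim
      case (elim s)
      have "(L s / s\<^sup>2) * s * I s (pi/2) = (L s * I s (pi/2)) / s"
        using elim by (simp add: power2_eq_square)
      then show ?case
        unfolding key[symmetric] by (simp add: cos_diff sum_divide_distrib)
    qed
  qed
  show "(\<Sum>k\<in>S. real_of_int (g k) * ipr k x) = 0"
    using tendsto_unique[OF trivial_limit_at_right_real 3 4] by simp
  have 5: "((\<lambda>s. \<Sum>k\<in>S. real_of_int (g k) * ((cos (s * ipr k x) - 1) / s\<^sup>2)) \<longlongrightarrow> (\<Sum>k\<in>S. real_of_int (g k) * - ((ipr k x)\<^sup>2 / 2))) (at_right 0)"
    by (intro tendsto_intros cos_quadratic_tendsto)
  \<comment> \<open>Subtracting the zeroth moment, which is 0 by \<open>m0\<close>, replaces cos by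
    cos - 1 and so prepares the division by s^2.\<close>
  have 6: "((\<lambda>s. \<Sum>k\<in>S. real_of_int (g k) * ((cos (s * ipr k x) - 1) / s\<^sup>2)) \<longlongrightarrow> (\<Sum>i\<in>UNIV. (x $ i)\<^sup>2) * I 0 0) (at_right 0)"
  proof (rule Lim_transform_eventually)
    show "((\<lambda>s. (L s / s\<^sup>2) * I s 0) \<longlongrightarrow> (\<Sum>i\<in>UNIV. (x $ i)\<^sup>2) * I 0 0) (at_right 0)"
      by (intro tendsto_mult L_lim I_lim)
    show "\<forall>\<^sub>F s in at_right 0. (L s / s\<^sup>2) * I s 0 = (\<Sum>k\<in>S. real_of_int (g k) * ((cos (s * ipr k x) - 1) / s\<^sup>2))"
      using ev
    proof eventually_elim
      case (elim s)
      have "(L s / s\<^sup>2) * I s 0 = (L s * I s 0 - (\<Sum>k\<in>S. real_of_int (g k))) / s\<^sup>2"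
        unfolding m0 by simp
      then show ?case
        unfolding key[symmetric] by (simp add: sum_divide_distrib sum_subtractf[symmetric] right_diff_distrib)
    qed
  qed
  have "(\<Sum>k\<in>S. real_of_int (g k) * - ((ipr k x)\<^sup>2 / 2)) = (\<Sum>i\<in>UNIV. (x $ i)\<^sup>2) * I 0 0"
    by (rule tendsto_unique[OF trivial_limit_at_right_real 5 6])
  moreover have "(\<Sum>k\<in>S. real_of_int (g k) * - ((ipr k x)\<^sup>2 / 2)) = - (1/2) * (\<Sum>k\<in>S. real_of_int (g k) * (ipr k x)\<^sup>2)"
    by (simp add: sum_distrib_left sum_negf)
  ultimately show "(\<Sum>k\<in>S. real_of_int (g k) * (ipr k x)\<^sup>2) = - 2 * ((\<Sum>i\<in>UNIV. (x $ i)\<^sup>2) * infsum a UNIV)"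
    unfolding I0 by linarith
qed

text \<open>Polarization: the directions \<open>axis i 1\<close> and
  \<open>axis i 1 + axis j 1\<close> determine the quadratic form. With A the sum of a, the result
  is A times the second moment matrix of \<open>fd\<close>, which is -2 times the identity.\<close>

lemma
  fixes g :: "int^'d \<Rightarrow> int" and a :: "int^'d \<Rightarrow> real"
  assumes g: "lpoly g" and a: "ell1 a" and eq: "act lap a = rseq g"
  defines "S \<equiv> {k. g k \<noteq> 0}"
  shows moment1: "(\<Sum>k\<in>S. real_of_int (g k) * real_of_int (k $ i)) = 0"
    and moment2: "(\<Sum>k\<in>S. real_of_int (g k) * (real_of_int (k $ i) * real_of_int (k $ j)))
      = (if i = j then - 2 * infsum a UNIV else 0)"
proof -
  have ipr1: "ipr k (axis i 1) = real_of_int (k $ i)" for k :: "int^'d" and i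
    by (simp add: ipr_def axis_def if_distrib cong: if_cong)
  have ipr2: "ipr k (axis i 1 + axis j 1) = real_of_int (k $ i) + real_of_int (k $ j)" for k :: "int^'d" and i j
    unfolding ipr1[symmetric] by (simp add: ipr_def distrib_left sum.distrib)
  have sq: "(\<Sum>l\<in>UNIV. ((axis i 1 :: real^'d) $ l)\<^sup>2) = 1" for i
  proof -
    have "(\<Sum>l\<in>UNIV. ((axis i 1 :: real^'d) $ l)\<^sup>2) = (\<Sum>l\<in>UNIV. if l = i then 1 else 0)"
      by (intro sum.cong) (auto simp: axis_def)
    then show ?thesis by simp
  qed
  show "(\<Sum>k\<in>S. real_of_int (g k) * real_of_int (k $ i)) = 0"
    using directional_moment1[OF g a eq, of "axis i 1"] by (simp add: S_def ipr1)
  have d: "(\<Sum>k\<in>S. real_of_int (g k) * (real_of_int (k $ i))\<^sup>2) = - 2 * infsum a UNIV" for i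
    using directional_moment2[OF g a eq, of "axis i 1"] by (simp add: S_def ipr1 sq)
  show "(\<Sum>k\<in>S. real_of_int (g k) * (real_of_int (k $ i) * real_of_int (k $ j)))
      = (if i = j then - 2 * infsum a UNIV else 0)"
  proof (cases "i = j")
    case True
    with d[of i] show ?thesis by (simp add: power2_eq_square)
  next
    case False
    have "(\<Sum>l\<in>UNIV. ((axis i 1 + axis j 1 :: real^'d) $ l)\<^sup>2)
       = (\<Sum>l\<in>UNIV. ((axis i 1 :: real^'d) $ l)\<^sup>2 + ((axis j 1 :: real^'d) $ l)\<^sup>2)"
      using False by (intro sum.cong) (auto simp: axis_def)
    also have "\<dots> = 2" unfolding sum.distrib sq by simp
    finally have "(\<Sum>k\<in>S. real_of_int (g k) * (real_of_int (k $ i) + real_of_int (k $ j))\<^sup>2) = - 4 * infsum a UNIV"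
      using directional_moment2[OF g a eq, of "axis i 1 + axis j 1"] unfolding ipr2 by (simp add: S_def)
    moreover have "(\<Sum>k\<in>S. real_of_int (g k) * (real_of_int (k $ i) + real_of_int (k $ j))\<^sup>2)
      = (\<Sum>k\<in>S. real_of_int (g k) * (real_of_int (k $ i))\<^sup>2) + (\<Sum>k\<in>S. real_of_int (g k) * (real_of_int (k $ j))\<^sup>2)
       + 2 * (\<Sum>k\<in>S. real_of_int (g k) * (real_of_int (k $ i) * real_of_int (k $ j)))"
      unfolding sum_distrib_left sum.distrib[symmetric] by (intro sum.cong) (auto simp: power2_eq_square algebra_simps)
    ultimately show ?thesis using False by (simp add: d)
  qed
qed

text \<open>The diagonal second moment is -2 A for A the sum of a. Subtracting the vanishing first
  moment turns the weights into the even numbers k_i^2 - k_i; halving them exhibits A as an integer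
  combination.\<close>

lemma infsum_Ints:
  fixes g :: "int^'d \<Rightarrow> int" and a :: "int^'d \<Rightarrow> real"
  assumes g: "lpoly g" and a: "ell1 a" and eq: "act lap a = rseq g"
  shows "infsum a UNIV \<in> \<int>"
proof -
  define S where "S = {k. g k \<noteq> 0}"
  fix i :: 'd
  have "even (m * (m - 1))" for m :: int unfolding even_mult_iff by presburger
  then have "even (m * m - m)" for m :: int by (simp only: right_diff_distrib mult_1_right)
  then have half: "m * m - m = 2 * ((m * m - m) div 2)" for m :: int by (rule dvd_mult_div_cancel[symmetric])
  have "- 2 * infsum a UNIV = (\<Sum>k\<in>S. real_of_int (g k) * (real_of_int (k $ i) * real_of_int (k $ i)))
      - (\<Sum>k\<in>S. real_of_int (g k) * real_of_int (k $ i))"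
    using moment1[OF g a eq, of i] moment2[OF g a eq, of i i] by (simp add: S_def)
  also have "\<dots> = (\<Sum>k\<in>S. real_of_int (g k) * real_of_int (k $ i * k $ i - k $ i))"
    by (simp add: sum_subtractf[symmetric] right_diff_distrib)
  also have "\<dots> = (\<Sum>k\<in>S. real_of_int (g k) * real_of_int (2 * ((k $ i * k $ i - k $ i) div 2)))"
    by (intro sum.cong refl arg_cong2[where f="(*)"] arg_cong[where f=real_of_int] half)
  also have "\<dots> = 2 * (\<Sum>k\<in>S. real_of_int (g k) * real_of_int ((k $ i * k $ i - k $ i) div 2))"
    by (simp only: of_int_mult of_int_numeral sum_distrib_left mult.left_commute)
  finally have "infsum a UNIV = - (\<Sum>k\<in>S. real_of_int (g k) * real_of_int ((k $ i * k $ i - k $ i) div 2))"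
    by simp
  also have "\<dots> \<in> \<int>" by (intro Ints_minus Ints_sum Ints_mult) auto
  finally show ?thesis .
qed

section \<open>Integrability of the inverse symbol\<close>

lemma
  fixes f :: "'a::euclidean_space \<Rightarrow> real \<Rightarrow> 'b::{real_normed_field,banach,second_countable_topology}"
  assumes "\<And>b. b \<in> Basis \<Longrightarrow> integrable lborel (f b)"
  shows integrable_lborel_prod: "integrable lborel (\<lambda>x. \<Prod>b\<in>Basis. f b (x \<bullet> b))"
    and integral_lborel_prod: "(LINT x|lborel. (\<Prod>b\<in>Basis. f b (x \<bullet> b))) = (\<Prod>b\<in>Basis. (LINT s|lborel. f b s))"
proof -
  interpret product_sigma_finite "\<lambda>_::'a. lborel::real measure" by standard
  have [measurable]: "f b \<in> borel_measurable borel" if "b \<in> Basis" for b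
    using borel_measurable_integrable[OF assms[OF that]] by simp
  have meas: "(\<lambda>f. \<Sum>b\<in>Basis. f b *\<^sub>R b) \<in> (\<Pi>\<^sub>M b\<in>(Basis::'a set). lborel) \<rightarrow>\<^sub>M (borel :: 'a measure)"
    by measurable
  have meas2: "(\<lambda>x::'a. \<Prod>b\<in>Basis. f b (x \<bullet> b)) \<in> borel_measurable borel"
    by measurable
  have comp: "(\<lambda>x. \<Prod>b\<in>Basis. f b ((\<Sum>c\<in>Basis. x c *\<^sub>R c) \<bullet> b)) = (\<lambda>x. \<Prod>b\<in>Basis. f b (x b))"
    by (intro ext prod.cong refl) (simp only: inner_sum_left_Basis)
  show "integrable lborel (\<lambda>x. \<Prod>b\<in>Basis. f b (x \<bullet> b))"
    by (subst lborel_eq, subst integrable_distr_eq[OF meas meas2], subst comp)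
      (rule product_integrable_prod[OF finite_Basis assms])
  show "(LINT x|lborel. (\<Prod>b\<in>Basis. f b (x \<bullet> b))) = (\<Prod>b\<in>Basis. (LINT s|lborel. f b s))"
    by (subst lborel_eq, subst integral_distr[OF meas meas2], subst comp)
      (rule product_integral_prod[OF finite_Basis assms])
qed

lemma prod_Basis_vec: "(\<Prod>b\<in>(Basis::(real^'d) set). h b) = (\<Prod>j\<in>UNIV. h (axis j 1))"
proof -
  have eq: "(Basis::(real^'d) set) = (\<lambda>j. axis j 1) ` UNIV"
    by (auto simp: Basis_vec_def)
  have "inj (\<lambda>j. axis j 1 :: real^'d)"
    by (auto simp: inj_on_def axis_eq_axis)
  then show ?thesis unfolding eq by (simp add: prod.reindex comp_def)
qed

lemma
  fixes f :: "'d::finite \<Rightarrow> real \<Rightarrow> 'b::{real_normed_field,banach,second_countable_topology}"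
  assumes "\<And>j. integrable lborel (f j)"
  shows integrable_vec_prod: "integrable lborel (\<lambda>x::real^'d. \<Prod>j\<in>UNIV. f j (x $ j))"
    and integral_vec_prod: "(LINT x|lborel. (\<Prod>j\<in>UNIV. f j ((x::real^'d) $ j))) = (\<Prod>j\<in>UNIV. (LINT s|lborel. f j s))"
proof -
  define g where "g b = f (SOME j. b = axis j 1)" for b :: "real^'d"
  have g: "g (axis j 1) = f j" for j
    unfolding g_def by (simp add: axis_eq_axis)
  have "integrable lborel (g b)" for b using assms by (simp add: g_def)
  note * = integrable_lborel_prod[of g, OF this] integral_lborel_prod[of g, OF this]
  show "integrable lborel (\<lambda>x::real^'d. \<Prod>j\<in>UNIV. f j (x $ j))"
    using *(1) by (simp add: prod_Basis_vec g inner_axis)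
  show "(LINT x|lborel. (\<Prod>j\<in>UNIV. f j ((x::real^'d) $ j))) = (\<Prod>j\<in>UNIV. (LINT s|lborel. f j s))"
    using *(2) by (simp add: prod_Basis_vec g inner_axis)
qed

abbreviation torus :: "(real^'d) measure" where "torus \<equiv> restrict_space lborel (cbox 0 One)"

lemma set_integral_torus: "(LINT t:cbox (0::real^'d) One|lborel. f t) = (LINT t|torus. f t)"
    for f :: "real^'d \<Rightarrow> 'b::{banach, second_countable_topology}"
  unfolding set_lebesgue_integral_def by (subst integral_restrict_space) auto

lemma integrable_torus_iff: "integrable torus f \<longleftrightarrow> integrable lborel (\<lambda>x. indicator (cbox (0::real^'d) One) x *\<^sub>R f x)"
    for f :: "real^'d \<Rightarrow> 'b::{banach, second_countable_topology}"
  by (rule integrable_restrict_space) auto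

lemma mem_unit_cube: "x \<in> cbox (0::real^'d) One \<longleftrightarrow> (\<forall>j. x $ j \<in> {0..1})"
proof -
  have "(One :: real^'d) $ j = 1" for j
    unfolding cart_eq_inner_axis[of One] by (simp add: inner_sum_left_Basis axis_in_Basis_iff
        inner_sum_left inner_Basis)
  then show ?thesis by (simp add: mem_box_cart)
qed

lemma indicator_cbox_prod:
  "indicator (cbox (0::real^'d) One) x = (\<Prod>j\<in>UNIV. indicator {0..1} (x $ j) :: 'b::comm_semiring_1)"
proof (cases "x \<in> cbox 0 One")
  case True
  then have "indicator {0..1} (x $ j) = (1::'b)" for j unfolding mem_unit_cube by simp
  with True show ?thesis by simp
next
  case False
  then obtain j where "x $ j \<notin> {0..1}" unfolding mem_unit_cube by auto
  then have "\<exists>j\<in>UNIV. indicator {0..1} (x $ j) = (0::'b)" by (intro bexI[of _ j]) auto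
  then have "(\<Prod>j\<in>UNIV. indicator {0..1} (x $ j) :: 'b) = 0" by (intro prod_zero) auto
  with False show ?thesis by simp
qed

text \<open>\<open>Fd\<close> vanishes at the corners of the cube; discarding the null boundary
  leaves points where \<open>Fd_pos\<close> and the coordinate bounds apply.\<close>

lemma AE_torus_interior: "AE t in (torus :: (real^'d) measure). \<forall>j\<in>UNIV. 0 < t $ j \<and> t $ j < 1"
proof -
  have ne: "AE t in (lborel::(real^'d) measure). t $ j \<noteq> c" for j c
    using AE_lborel_inner_neq[of "axis j 1 :: real^'d" c] by (simp add: inner_axis axis_in_Basis_iff)
  have "AE t in (lborel::(real^'d) measure). t \<in> cbox 0 One \<longrightarrow> 0 < t $ j \<and> t $ j < 1" for j
    using ne[of j 0] ne[of j 1] by eventually_elim (simp add: mem_unit_cube less_le)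
  then have "AE t in torus. 0 < t $ j \<and> t $ j < 1" for j :: 'd
    by (subst AE_restrict_space_iff) auto
  then show ?thesis by (intro AE_finite_allI) auto
qed

section \<open>Lower bounds for the symbol\<close>

text \<open>Jordan's inequality with 1/2 in place of 2/pi. Put y = x/2: the mean value theorem gives
  sin y >= y cos y, doubling gives sin x >= x (cos y)^2, and (cos y)^2 >= 1/2 since cos x >=
  0.\<close>

lemma sin_ge_half:
  fixes x :: real
  assumes "0 \<le> x" "x \<le> pi / 2"
  shows "x / 2 \<le> sin x"
proof (cases "x = 0")
  case False
  define y where "y = x / 2"
  have y: "0 < y" "y < pi / 2" using assms False by (auto simp: y_def)
  have "\<exists>z. 0 < z \<and> z < y \<and> sin y - sin 0 = (y - 0) * cos z"
    by (rule MVT2) (use y in \<open>auto intro!: derivative_eq_intros\<close>)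
  then obtain z where z: "0 < z" "z < y" "sin y = y * cos z" by auto
  have "cos y \<le> cos z" using z y by (intro cos_monotone_0_pi_le) auto
  then have s: "y * cos y \<le> sin y" using y z by simp
  have c: "0 \<le> cos y" using y by (intro cos_ge_zero) auto
  have "0 \<le> cos x" using assms by (intro cos_ge_zero) auto
  then have "1 / 2 \<le> (cos y)\<^sup>2" using cos_double_cos[of y] by (simp add: y_def)
  then have "x / 2 \<le> 2 * (y * cos y) * cos y"
    using y mult_left_mono[of "1/2" "(cos y)\<^sup>2" x] by (simp add: y_def power2_eq_square)
  also have "\<dots> \<le> 2 * sin y * cos y" using s c by (intro mult_right_mono) auto
  also have "\<dots> = sin x" using sin_double[of y] by (simp add: y_def)
  finally show ?thesis .
qed simp

text \<open>The right side is 4 (sin (pi s))^2. The comparison function s (1 - s) treats the zeros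
  at both ends alike, and its powers are Beta integrands.\<close>

lemma one_minus_cos_ge:
  fixes s :: real
  assumes "0 \<le> s" "s \<le> 1"
  shows "(s * (1 - s))\<^sup>2 \<le> 2 - 2 * cos (2 * pi * s)"
proof -
  have *: "s * (1 - s) \<le> sin (pi * s)" if "0 \<le> s" "s \<le> 1/2" for s :: real
  proof -
    have "s * (1 - s) \<le> s * 1" using that by (intro mult_left_mono) auto
    also have "\<dots> \<le> pi * s / 2" using that pi_ge_two mult_right_mono[of 2 pi s] by simp
    also have "\<dots> \<le> sin (pi * s)" using that by (intro sin_ge_half) auto
    finally show ?thesis .
  qed
  have "s * (1 - s) \<le> sin (pi * s)"
  proof (cases "s \<le> 1/2")
    case False
    have "sin (pi * s) = sin (pi * (1 - s))" by (simp add: right_diff_distrib)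
    with False *[of "1 - s"] assms show ?thesis by (simp add: mult.commute)
  qed (use * assms in auto)
  then have "(s * (1 - s))\<^sup>2 \<le> (sin (pi * s))\<^sup>2"
    using assms by (intro power_mono) auto
  moreover have "2 - 2 * cos (2 * pi * s) = 4 * (sin (pi * s))\<^sup>2"
    using cos_double_sin[of "pi * s"] by (simp add: mult_ac)
  ultimately show ?thesis using zero_le_power2[of "sin (pi * s)"] by linarith
qed

lemma Fd_eq: "Fd t = (\<Sum>j\<in>UNIV. 2 - 2 * cos (2 * pi * t $ j))"
  by (simp add: Fd_def sum_subtractf sum_distrib_left)

lemma Fd_ge_component: "2 - 2 * cos (2 * pi * t $ j) \<le> Fd t"
  unfolding Fd_eq by (rule member_le_sum) auto

lemma Fd_nonneg: "0 \<le> Fd t"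
  unfolding Fd_eq by (rule sum_nonneg) simp

lemma Fd_le: "Fd (t :: real^'d) \<le> 4 * real CARD('d)"
proof -
  have "2 - 2 * cos x \<le> 4" for x :: real using cos_ge_minus_one[of x] by linarith
  then have "Fd t \<le> (\<Sum>j\<in>(UNIV :: 'd set). 4)"
    unfolding Fd_eq by (intro sum_mono)
  then show ?thesis by simp
qed

lemma Fd_pos: "(\<And>j. 0 < t $ j \<and> t $ j < 1) \<Longrightarrow> 0 < Fd t"
proof -
  assume t: "\<And>j. 0 < t $ j \<and> t $ j < 1"
  fix j
  have "0 < (t $ j * (1 - t $ j))\<^sup>2" using t[of j] by simp
  also have "\<dots> \<le> 2 - 2 * cos (2 * pi * t $ j)" using t[of j] by (intro one_minus_cos_ge) auto
  also have "\<dots> \<le> Fd t" by (rule Fd_ge_component)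
  finally show ?thesis .
qed

text \<open>Each coordinate alone bounds \<open>F\<close> from below, so a negative power of \<open>F\<close> is bounded by a
  product of one-dimensional functions with exponents above \<open>-1\<close>.\<close>

lemma Fd_powr_le:
  fixes t :: "real^'d"
  assumes t: "\<And>j. 0 < t $ j \<and> t $ j < 1" and p: "p \<ge> 0"
  shows "Fd t powr (- p) \<le> (\<Prod>j\<in>UNIV. (t $ j * (1 - t $ j)) powr (- (2 * p / real CARD('d))))"
proof -
  define q where "q = p / real CARD('d)"
  have q: "q \<ge> 0" "q * real CARD('d) = p" using p by (auto simp: q_def)
  have F: "Fd t > 0" using t by (rule Fd_pos)
  have "Fd t powr (- p) = (\<Prod>j\<in>(UNIV::'d set). Fd t powr (- q))"
    using F by (simp add: powr_realpow[symmetric] powr_powr q del: powr_realpow)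
  also have "\<dots> \<le> (\<Prod>j\<in>UNIV. (t $ j * (1 - t $ j)) powr (- (2 * q)))"
  proof (intro prod_mono conjI)
    fix j
    have m: "0 < t $ j * (1 - t $ j)" using t[of j] by simp
    have m2: "(t $ j * (1 - t $ j))\<^sup>2 = (t $ j * (1 - t $ j)) powr 2" using m by simp
    have "(t $ j * (1 - t $ j))\<^sup>2 \<le> 2 - 2 * cos (2 * pi * t $ j)"
      using t[of j] by (intro one_minus_cos_ge) auto
    also note Fd_ge_component
    finally have "Fd t powr (- q) \<le> ((t $ j * (1 - t $ j))\<^sup>2) powr (- q)"
      using m q by (intro powr_mono2') auto
    also have "\<dots> = (t $ j * (1 - t $ j)) powr (- (2 * q))"
      unfolding m2 by (simp add: powr_powr)
    finally show "Fd t powr (- q) \<le> (t $ j * (1 - t $ j)) powr (- (2 * q))" .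
  qed simp
  finally show ?thesis by (simp add: q_def)
qed

lemma integrable_Beta_kernel:
  fixes a :: real
  assumes "a < 1"
  shows "integrable lborel (\<lambda>s. indicator {0..1} s * (s * (1 - s)) powr (- a))"
proof -
  have "((\<lambda>s. s powr ((1 - a) - 1) * (1 - s) powr ((1 - a) - 1)) has_integral Beta (1 - a) (1 - a)) {0..1}"
    using assms by (intro has_integral_Beta_real) auto
  moreover have "s powr ((1 - a) - 1) * (1 - s) powr ((1 - a) - 1) = (s * (1 - s)) powr (- a)" if "s \<in> {0..1}" for s
    using that by (simp add: powr_mult)
  ultimately have I: "((\<lambda>s. (s * (1 - s)) powr (- a)) has_integral Beta (1 - a) (1 - a)) {0..1}"
    by (subst has_integral_cong[symmetric]) auto
  have "integral\<^sup>N lborel (\<lambda>s. indicator {0..1} s * (s * (1 - s)) powr (- a)) = Beta (1 - a) (1 - a)"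
    by (rule nn_integral_has_integral_lebesgue[OF _ I]) simp
  then show ?thesis
    by (intro integrableI_nonneg) (auto intro!: AE_I2)
qed

text \<open>The exponent 2 p/d of each coordinate factor is below 1, so its Beta integral converges.
  The Green function uses p = 1 for d >= 3 and p = 1/2 for d = 2.\<close>

lemma integrable_Fd_powr:
  assumes p: "0 \<le> p" "2 * p < real CARD('d)"
  shows "integrable torus (\<lambda>t :: real^'d. Fd t powr (- p))"
proof -
  define a where "a = 2 * p / real CARD('d)"
  have a: "a < 1" using p by (simp add: a_def divide_less_eq)
  have meas: "(\<lambda>t::real^'d. Fd t powr (- p)) \<in> borel_measurable borel"
  proof -
    have [measurable]: "(Fd :: real^'d \<Rightarrow> real) \<in> borel_measurable borel"
      unfolding Fd_def[abs_def] by (intro borel_measurable_continuous_onI continuous_intros)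
    show ?thesis by measurable
  qed
  have "integrable lborel (\<lambda>x::real^'d. \<Prod>j\<in>UNIV. indicator {0..1} (x $ j) * (x $ j * (1 - x $ j)) powr (- a))"
    using integrable_Beta_kernel[OF a] by (rule integrable_vec_prod)
  then have "integrable torus (\<lambda>x::real^'d. \<Prod>j\<in>UNIV. (x $ j * (1 - x $ j)) powr (- a))"
    unfolding integrable_torus_iff by (simp add: indicator_cbox_prod prod.distrib)
  then show ?thesis
  proof (rule Bochner_Integration.integrable_bound)
    show "(\<lambda>t::real^'d. Fd t powr (- p)) \<in> borel_measurable torus"
      using meas by (intro measurable_restrict_space1) simp
    show "AE t in torus. norm (Fd t powr (- p)) \<le> norm (\<Prod>j\<in>UNIV. ((t :: real^'d) $ j * (1 - t $ j)) powr (- a))"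
      using AE_torus_interior
    proof eventually_elim
      case (elim t)
      then have "Fd t powr (- p) \<le> (\<Prod>j\<in>UNIV. (t $ j * (1 - t $ j)) powr (- a))"
        unfolding a_def by (intro Fd_powr_le p) auto
      then show ?case by (simp add: prod_nonneg)
    qed
  qed
qed

section \<open>The Green function\<close>

abbreviation tcos :: "real^'d \<Rightarrow> int^'d \<Rightarrow> real" where
  "tcos t \<equiv> (\<lambda>n. cos (2 * pi * ipr n t))"

lemma act_lap_tcos: "act lap (tcos t) n = Fd t * tcos t n"
  using act_lap_cos[where \<phi>=0 and n=n and x="(2 * pi) *\<^sub>R t"] by (simp add: Fd_eq)

lemma cos_eq_exp: "Re (exp (- (2 * pi * \<i> * complex_of_real x))) = cos (2 * pi * x)"
  by (simp add: Re_exp)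

lemma integral_exp_unit_interval:
  "(LINT s|lborel. indicator {0..1} s *\<^sub>R exp (- (2 * pi * \<i> * complex_of_real (real_of_int m * s)))) = (if m = 0 then 1 else 0)"
proof (cases "m = 0")
  case False
  define c where "c = - (2 * pi * \<i> * of_int m)"
  have c: "c \<noteq> 0" using False by (simp add: c_def)
  have e: "exp (- (2 * pi * \<i> * complex_of_real (real_of_int m * s))) = exp (c * of_real s)" for s
    by (simp add: c_def mult_ac)
  have "((\<lambda>s. exp (c * of_real s)) has_integral exp (c * of_real 1) / c - exp (c * of_real 0) / c) {0..1}"
  proof (rule fundamental_theorem_of_calculus)
    fix s :: real
    have "((\<lambda>z. exp (c * z) / c) has_field_derivative exp (c * of_real s)) (at (of_real s))"
      using c by (auto intro!: derivative_eq_intros)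
    then show "((\<lambda>s. exp (c * of_real s) / c) has_vector_derivative exp (c * of_real s)) (at s within {0..1})"
      by (rule has_vector_derivative_real_field)
  qed simp
  moreover have "exp c = 1"
    unfolding c_def exp_eq_1 by (auto intro!: exI[of _ "- m"])
  ultimately have 1: "integral {0..1} (\<lambda>s. exp (c * of_real s)) = 0"
    by (simp add: integral_unique)
  have "set_integrable lborel {0..1} (\<lambda>s. exp (c * complex_of_real s))"
    by (intro borel_integrable_compact[of "{0..1}", unfolded set_integrable_def[symmetric]] continuous_intros) (auto simp: set_integrable_def)
  from set_borel_integral_eq_integral(2)[OF this] show ?thesis
    using False 1 unfolding e by (simp add: set_lebesgue_integral_def)
qed simp

lemma integrable_exp_unit_interval:
  "integrable lborel (\<lambda>s. indicator {0..1} s *\<^sub>R exp (- (2 * pi * \<i> * complex_of_real (real_of_int m * s))))"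
  by (intro borel_integrable_compact continuous_intros) auto

lemma exp_ipr_prod:
  "exp (- (2 * pi * \<i> * complex_of_real (ipr n t))) = (\<Prod>j\<in>UNIV. exp (- (2 * pi * \<i> * complex_of_real (real_of_int (n $ j) * t $ j))))"
  by (simp add: exp_sum[symmetric] ipr_def sum_negf sum_distrib_left)

lemma indicator_exp_prod:
  "indicator (cbox (0::real^'d) One) t *\<^sub>R exp (- (2 * pi * \<i> * complex_of_real (ipr n t)))
    = (\<Prod>j\<in>UNIV. indicator {0..1} (t $ j) *\<^sub>R exp (- (2 * pi * \<i> * complex_of_real (real_of_int (n $ j) * t $ j))))"
  unfolding exp_ipr_prod indicator_cbox_prod scaleR_conv_of_real prod.distrib by simp

lemma integrable_exp_torus:
  "integrable (torus :: (real^'d) measure) (\<lambda>t. exp (- (2 * pi * \<i> * complex_of_real (ipr n t))))"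
  unfolding integrable_torus_iff indicator_exp_prod
  by (rule integrable_vec_prod) (rule integrable_exp_unit_interval)

lemma integral_exp_torus:
  "(LINT t|(torus :: (real^'d) measure). exp (- (2 * pi * \<i> * complex_of_real (ipr n t)))) = (if n = 0 then 1 else 0)"
proof -
  have "(LINT t|(torus :: (real^'d) measure). exp (- (2 * pi * \<i> * complex_of_real (ipr n t))))
      = (\<Prod>j\<in>UNIV. if n $ j = 0 then 1 else 0)"
    unfolding set_integral_torus[symmetric] set_lebesgue_integral_def indicator_exp_prod
    by (subst integral_vec_prod) (simp_all only: integrable_exp_unit_interval integral_exp_unit_interval)
  also have "\<dots> = (if n = 0 then 1 else 0)"
    by (auto simp: vec_eq_iff intro!: prod_zero)
  finally show ?thesis .
qed

lemma integrable_tcos: "integrable (torus :: (real^'d) measure) (\<lambda>t. tcos t n)"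
  using integrable_Re[OF integrable_exp_torus] unfolding cos_eq_exp .

lemma integral_tcos: "(LINT t|(torus :: (real^'d) measure). tcos t n) = (if n = 0 then 1 else 0)"
  using integral_Re[OF integrable_exp_torus[of n]] unfolding cos_eq_exp integral_exp_torus by simp

text \<open>This makes the integrand for \<open>d = 2\<close> of order \<open>F^(-1/2)\<close>, which is integrable although \<open>1 / F\<close> is not.\<close>

lemma norm_exp_minus_one_le:
  fixes n :: "int^'d"
  shows "\<exists>C. \<forall>t. norm (exp (- (2 * pi * \<i> * complex_of_real (ipr n t))) - 1) \<le> C * sqrt (Fd t)"
proof -
  define e where "e n t = exp (- (2 * pi * \<i> * complex_of_real (ipr n t)))" for n :: "int^'d" and t
  have norm_e: "norm (e n t) = 1" for n t
    by (simp add: e_def norm_exp_eq_Re)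
  have e_add: "e (a + b) t = e a t * e b t" for a b t
    by (simp add: e_def ipr_add distrib_left exp_add[symmetric] algebra_simps)
  have e_0: "e 0 t = 1" for t by (simp add: e_def)
  have "{n. \<exists>C. \<forall>t. norm (e n t - 1) \<le> C * sqrt (Fd t)} = UNIV"
  proof (rule subgroup_UNIV, unfold mem_Collect_eq, goal_cases)
    case 1
    show ?case by (auto simp: e_0 intro!: exI[of _ 0])
  next
    case (2 a b)
    then obtain A B where A: "\<And>t. norm (e a t - 1) \<le> A * sqrt (Fd t)"
      and B: "\<And>t. norm (e b t - 1) \<le> B * sqrt (Fd t)" by blast
    have "norm (e (a + b) t - 1) \<le> (A + B) * sqrt (Fd t)" for t
    proof -
      have "e (a + b) t - 1 = e a t * (e b t - 1) + (e a t - 1)"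
        by (simp add: e_add algebra_simps)
      then have "norm (e (a + b) t - 1) \<le> norm (e a t) * norm (e b t - 1) + norm (e a t - 1)"
        by (metis norm_triangle_ineq norm_mult)
      then show ?thesis
        using A[of t] B[of t] by (simp add: norm_e distrib_right)
    qed
    then show ?case by blast
  next
    case (3 a)
    have "norm (e (- a) t - 1) = norm (e a t - 1)" for t
    proof -
      have "e a t * e (- a) t = 1" using e_add[of a "- a" t] by (simp add: e_0)
      then have "e (- a) t - 1 = - (e (- a) t * (e a t - 1))" by (simp add: algebra_simps)
      then show ?thesis by (metis norm_minus_cancel norm_mult norm_e mult_1)
    qed
    with 3 show ?case by simp
  next
    case (4 i)
    have "norm (e (axis i 1) t - 1) \<le> 1 * sqrt (Fd t)" for t
    proof -
      define x where "x = 2 * pi * t $ i"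
      have ex: "e (axis i 1) t = cis (- x)"
        by (simp add: e_def x_def cis_conv_exp mult_ac)
      have "(norm (e (axis i 1) t - 1))\<^sup>2 = (cos x - 1)\<^sup>2 + (sin x)\<^sup>2"
        unfolding ex cmod_power2 by simp
      also have "\<dots> = 2 - 2 * cos x"
        using sin_cos_squared_add[of x] by (simp add: power2_eq_square algebra_simps)
      also have "\<dots> \<le> Fd t" unfolding x_def using Fd_ge_component[of t i] by (simp add: mult.assoc)
      finally show ?thesis by (simp add: real_le_rsqrt)
    qed
    then show ?case by blast
  qed
  then show ?thesis unfolding e_def by blast
qed

section \<open>The Fourier integral of the Green function\<close>

text \<open>The constant subtracted from the character in the two cases of \<open>wd\<close>, so
  that d = 2 and d >= 3 share their proofs.\<close>

definition wshift :: "'d::finite itself \<Rightarrow> real" where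
  "wshift _ = (if CARD('d) = 2 then 1 else 0)"

lemma integrable_wd_kernel:
  fixes n :: "int^'d"
  assumes d: "CARD('d) \<ge> 2"
  shows "integrable torus (\<lambda>t. (exp (- (2 * pi * \<i> * complex_of_real (ipr n t))) - complex_of_real (wshift TYPE('d))) / complex_of_real (Fd t))"
    (is "integrable torus ?E")
proof -
  \<comment> \<open>The numerator is of order F^(1 - p): bounded for d >= 3, of order F^(1/2) for d
    = 2.\<close>
  define p where "p = (if CARD('d) = 2 then 1/2 else (1::real))"
  have p: "0 \<le> p" "2 * p < real CARD('d)" using d by (auto simp: p_def)
  \<comment> \<open>As \<open>0 powr 0 = 0\<close>, the bound for p = 1 fails at the zeros of
    \<open>Fd\<close>; the second alternative sets these points aside.\<close>
  obtain C where C: "\<And>t. norm (exp (- (2 * pi * \<i> * complex_of_real (ipr n t))) - complex_of_real (wshift TYPE('d))) \<le> C * Fd t powr (1 - p)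
      \<or> Fd t \<le> 0"
  proof (cases "CARD('d) = 2")
    case True
    obtain C where "\<And>t. norm (exp (- (2 * pi * \<i> * complex_of_real (ipr n t))) - 1) \<le> C * sqrt (Fd t)"
      using norm_exp_minus_one_le[of n] by blast
    with True that[of C] show ?thesis by (simp add: p_def wshift_def powr_half_sqrt Fd_nonneg)
  next
    case False
    with that[of 1] show ?thesis by (fastforce simp: p_def wshift_def norm_exp_eq_Re)
  qed
  show ?thesis
  proof (rule Bochner_Integration.integrable_bound)
    show "integrable torus (\<lambda>t :: real^'d. C * Fd t powr (- p))"
      by (intro integrable_mult_right integrable_Fd_powr p)
    have [measurable]: "(Fd :: real^'d \<Rightarrow> real) \<in> borel_measurable borel" "ipr n \<in> borel_measurable borel"
      unfolding Fd_def[abs_def] ipr_def[abs_def]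
      by (intro borel_measurable_continuous_onI continuous_intros)+
    have "?E \<in> borel_measurable borel" by measurable
    then show "?E \<in> borel_measurable torus"
      by (intro measurable_restrict_space1) simp
    show "AE t in torus. norm (?E t) \<le> norm (C * Fd t powr (- p))"
      using AE_torus_interior
    proof eventually_elim
      case (elim t)
      then have F: "Fd t > 0" by (intro Fd_pos) auto
      then have "norm (?E t) \<le> C * Fd t powr (1 - p) / Fd t"
        using C[of t] by (simp add: norm_divide divide_right_mono)
      also have "\<dots> = C * Fd t powr (- p)"
        using F by (simp add: powr_diff powr_minus field_simps)
      also have "\<dots> \<le> \<bar>C * Fd t powr (- p)\<bar>" by (rule abs_ge_self)
      finally show ?case by (simp only: real_norm_def)
    qed
  qed
qed

lemma
  fixes n :: "int^'d"
  assumes d: "CARD('d) \<ge> 2"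
  shows integrable_wd_real_kernel: "integrable torus (\<lambda>t. (tcos t n - wshift TYPE('d)) / Fd t)"
    and wd_eq: "wd n = (LINT t|torus. (tcos t n - wshift TYPE('d)) / Fd t)"
proof -
  have Re: "Re ((exp (- (2 * pi * \<i> * complex_of_real (ipr n t))) - complex_of_real (wshift TYPE('d))) / complex_of_real (Fd t))
     = (tcos t n - wshift TYPE('d)) / Fd t" for t
    using cos_eq_exp[of "ipr n t"] by (simp add: Re_divide_of_real)
  show "integrable torus (\<lambda>t. (tcos t n - wshift TYPE('d)) / Fd t)"
    using integrable_Re[OF integrable_wd_kernel[OF d, of n]] unfolding Re .
  have "wd n = Re (LINT t|torus. (exp (- (2 * pi * \<i> * complex_of_real (ipr n t))) - complex_of_real (wshift TYPE('d))) / complex_of_real (Fd t))"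
    by (simp add: wd_def set_integral_torus wshift_def)
  then show "wd n = (LINT t|torus. (tcos t n - wshift TYPE('d)) / Fd t)"
    using integral_Re[OF integrable_wd_kernel[OF d, of n]] unfolding Re by simp
qed

lemma wd_minus: "CARD('d) \<ge> 2 \<Longrightarrow> wd (- n :: int^'d) = wd n"
  by (simp add: wd_eq)

text \<open>Augmentation 0 kills the constant \<open>wshift\<close>, which leaves one formula for
  all d >= 2.\<close>

lemma
  fixes p :: "int^'d \<Rightarrow>\<^sub>0 real"
  assumes d: "CARD('d) \<ge> 2" and p: "aug p = 0"
  shows integrable_act_kernel: "integrable torus (\<lambda>t. act p (tcos t) n / Fd t)"
    and act_wd: "act p wd n = (LINT t|torus. act p (tcos t) n / Fd t)"
proof -
  have eq: "act p (tcos t) n / Fd t = (\<Sum>k\<in>keys p. lookup p k * ((tcos t (n - k) - wshift TYPE('d)) / Fd t))" for t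
  proof -
    have "act p (tcos t) n = (\<Sum>k\<in>keys p. lookup p k * (tcos t (n - k) - wshift TYPE('d)))"
      using p by (simp add: act_def right_diff_distrib sum_subtractf aug_eq_sum flip: sum_distrib_right)
    then show ?thesis by (simp add: sum_divide_distrib)
  qed
  show "integrable torus (\<lambda>t. act p (tcos t) n / Fd t)"
    unfolding eq by (intro Bochner_Integration.integrable_sum integrable_mult_right integrable_wd_real_kernel d)
  show "act p wd n = (LINT t|torus. act p (tcos t) n / Fd t)"
    unfolding eq unfolding act_def wd_eq[OF d]
    by (subst Bochner_Integration.integral_sum)
      (simp_all only: integrable_mult_right integrable_wd_real_kernel[OF d] Bochner_Integration.integral_mult_right_zero)
qed

text \<open>The eigenvalue \<open>Fd\<close> of the Laplacian cancels the denominator almost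
  everywhere, and orthogonality of characters leaves the delta.\<close>

lemma act_lap_wd:
  assumes d: "CARD('d) \<ge> 2"
  shows "act lap wd (n :: int^'d) = (if n = 0 then 1 else 0)"
proof -
  have "act lap wd n = (LINT t|torus. act lap (tcos t) n / Fd t)"
    by (rule act_wd[OF d aug_lap])
  also have "\<dots> = (LINT t|(torus :: (real^'d) measure). tcos t n)"
  proof (rule integral_cong_AE)
    show "(\<lambda>t. act lap (tcos t) n / Fd t) \<in> borel_measurable torus"
      using integrable_act_kernel[OF d aug_lap] by (rule borel_measurable_integrable)
    show "(\<lambda>t. tcos t n) \<in> borel_measurable (torus :: (real^'d) measure)"
      using integrable_tcos by (rule borel_measurable_integrable)
    show "AE t in torus. act lap (tcos t) n / Fd t = tcos t n"
      using AE_torus_interior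
    proof eventually_elim
      case (elim t)
      then have "Fd t > 0" by (intro Fd_pos) auto
      then show ?case by (simp add: act_lap_tcos)
    qed
  qed
  finally show ?thesis by (simp add: integral_tcos)
qed

section \<open>The Neumann series of the Green function\<close>

lemma act_walk_power_tcos:
  "act (walk ^ M) (tcos t) n = (1 - Fd t / (4 * real CARD('d))) ^ M * tcos t (n :: int^'d)"
proof (induction M arbitrary: n)
  case (Suc M)
  define c where "c = 1 - Fd t / (4 * real CARD('d))"
  have w: "act walk (tcos t) n = c * tcos t n" for n
    by (simp only: walk_def act_diff act_mult act_one act_single act_lap_tcos c_def) (simp add: left_diff_distrib)
  have "act (walk ^ M) (tcos t) = (\<lambda>n. c ^ M * tcos t n)"
    by (rule ext) (simp only: Suc c_def)
  then have "act (walk ^ Suc M) (tcos t) n = act walk (\<lambda>n. c ^ M * tcos t n) n"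
    by (simp add: act_mult)
  then show ?case by (simp add: act_scale_right w c_def)
qed simp

text \<open>The remainder of the Neumann series. The walk multiplies the integrand by powers of 1 -
  F/(4 d), which lies in [0, 1] and is below 1 inside the cube, so dominated convergence
  applies.\<close>

lemma act_walk_power_wd_tendsto:
  fixes k :: "int^'d \<Rightarrow>\<^sub>0 real"
  assumes d: "CARD('d) \<ge> 2" and k: "aug k = 0"
  shows "(\<lambda>M. act (k * walk ^ M) wd n) \<longlonglongrightarrow> 0"
proof -
  define c where "c t = 1 - Fd t / (4 * real CARD('d))" for t :: "real^'d"
  have c01: "0 \<le> c t" "c t \<le> 1" for t
    using Fd_nonneg[of t] Fd_le[of t] by (auto simp: c_def divide_simps)
  have act: "act (k * walk ^ M) (tcos t) n = c t ^ M * act k (tcos t) n" for M t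
  proof -
    have "act (walk ^ M) (tcos t) = (\<lambda>n. c t ^ M * tcos t n)"
      by (rule ext) (simp only: act_walk_power_tcos c_def)
    then show ?thesis by (simp add: act_mult act_scale_right)
  qed
  have aug: "aug (k * walk ^ M) = 0" for M using k by (simp add: aug_mult)
  have "(\<lambda>M. LINT t|torus. act (k * walk ^ M) (tcos t) n / Fd t) \<longlonglongrightarrow> (LINT t|(torus :: (real^'d) measure). 0)"
  proof (rule integral_dominated_convergence[where w="\<lambda>t. \<bar>act k (tcos t) n / Fd t\<bar>"])
    show "(\<lambda>t. act (k * walk ^ M) (tcos t) n / Fd t) \<in> borel_measurable torus" for M
      using integrable_act_kernel[OF d aug] by (rule borel_measurable_integrable)
    show "integrable torus (\<lambda>t. \<bar>act k (tcos t) n / Fd t\<bar>)"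
      using integrable_act_kernel[OF d k] by (rule integrable_abs)
    show "AE t in torus. norm (act (k * walk ^ M) (tcos t) n / Fd t) \<le> \<bar>act k (tcos t) n / Fd t\<bar>" for M
    proof (rule AE_I2)
      fix t
      have "\<bar>c t ^ M\<bar> \<le> 1" using c01[of t] by (simp add: power_le_one)
      then show "norm (act (k * walk ^ M) (tcos t) n / Fd t) \<le> \<bar>act k (tcos t) n / Fd t\<bar>"
        unfolding act by (simp add: abs_mult divide_right_mono mult_left_le_one_le)
    qed
    show "AE t in torus. (\<lambda>M. act (k * walk ^ M) (tcos t) n / Fd t) \<longlonglongrightarrow> 0"
      using AE_torus_interior
    proof eventually_elim
      case (elim t)
      then have "Fd t > 0" by (intro Fd_pos) auto
      then have "c t < 1" by (simp add: c_def)
      then have "(\<lambda>M. c t ^ M * (act k (tcos t) n / Fd t)) \<longlonglongrightarrow> 0 * (act k (tcos t) n / Fd t)"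
        using c01[of t] by (intro tendsto_intros LIMSEQ_power_zero) auto
      then show ?case unfolding act by simp
    qed
  qed simp
  then show ?thesis by (simp add: act_wd[OF d aug])
qed

text \<open>Since 1 - \<mu> = f/(4 d) divides 1 - \<mu>^M and f w is the delta, the partial sum up
  to M is k w minus the remainder (k \<mu>^M) w.\<close>

lemma act_wd_sums:
  fixes k :: "int^'d \<Rightarrow>\<^sub>0 real"
  assumes d: "CARD('d) \<ge> 2" and k: "aug k = 0"
  shows "(\<lambda>N. lookup (k * walk ^ N) n / (4 * real CARD('d))) sums act k wd n"
proof -
  define s where "s = single (0::int^'d) (1 / (4 * real CARD('d)))"
  have sl: "s * lap = 1 - walk"
    by (simp add: s_def walk_def)
  have lapw: "act lap wd = (\<lambda>n::int^'d. if n = 0 then 1 else 0)"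
    by (rule ext) (rule act_lap_wd[OF d])
  have "act k wd n - act (k * walk ^ M) wd n = (\<Sum>N<M. lookup (k * walk ^ N) n / (4 * real CARD('d)))" for M
  proof -
    have "k - k * walk ^ M = k * (1 - walk ^ M)" by (simp add: right_diff_distrib)
    also have "\<dots> = k * ((s * lap) * (\<Sum>N<M. walk ^ N))" by (simp only: one_diff_power_eq sl)
    also have "\<dots> = k * (\<Sum>N<M. walk ^ N) * s * lap" by (simp only: mult_ac)
    finally have "act k wd n - act (k * walk ^ M) wd n = act (k * (\<Sum>N<M. walk ^ N) * s * lap) wd n"
      by (simp add: act_diff[symmetric])
    also have "\<dots> = lookup (s * (\<Sum>N<M. k * walk ^ N)) n"
      by (simp only: act_mult[of _ lap] lapw lookup_eq_act[symmetric]) (simp add: mult_ac sum_distrib_left)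
    also have "\<dots> = (\<Sum>N<M. lookup (k * walk ^ N) n / (4 * real CARD('d)))"
      by (simp add: s_def lookup_mult_eq_act[of "single _ _"] lookup_sum sum_divide_distrib)
    finally show ?thesis .
  qed
  then have "(\<lambda>M. \<Sum>N<M. lookup (k * walk ^ N) n / (4 * real CARD('d))) = (\<lambda>M. act k wd n - act (k * walk ^ M) wd n)"
    by simp
  moreover have "(\<lambda>M. act k wd n - act (k * walk ^ M) wd n) \<longlonglongrightarrow> act k wd n - 0"
    by (intro tendsto_intros act_walk_power_wd_tendsto d k)
  ultimately show ?thesis by (simp add: sums_def)
qed

lemma ell1_lookup: "ell1 (lookup p)"
  and integral_lookup: "(LINT n|count_space UNIV. lookup p n) = aug p"
  and integral_abs_lookup: "(LINT n|count_space UNIV. \<bar>lookup p n\<bar>) = l1 p"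
proof -
  have S: "ell1 (f :: 'a \<Rightarrow> real)" "(LINT n|count_space UNIV. f n) = sum f (keys p)"
    if "\<And>n. n \<notin> keys p \<Longrightarrow> f n = 0" for f
  proof -
    have "{n. f n \<noteq> 0} \<subseteq> keys p" using that by auto
    then have "finite {n. f n \<noteq> 0}" by (rule finite_subset) simp
    then show "ell1 f" unfolding ell1_iff_summable by (intro finite_nonzero_values_imp_summable_on) simp
    then have "(LINT n|count_space UNIV. f n) = infsum f UNIV" by (rule infsum_eq_integral[symmetric])
    also have "\<dots> = infsum f (keys p)" using that by (intro infsum_cong_neutral) auto
    finally show "(LINT n|count_space UNIV. f n) = sum f (keys p)" by simp
  qed
  show "ell1 (lookup p)" "(LINT n|count_space UNIV. lookup p n) = aug p"
    using S[of "lookup p"] by (auto simp: in_keys_iff aug_eq_sum)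
  show "(LINT n|count_space UNIV. \<bar>lookup p n\<bar>) = l1 p"
    using S(2)[of "\<lambda>n. \<bar>lookup p n\<bar>"] by (auto simp: in_keys_iff l1_def)
qed

text \<open>Summable norms upgrade the pointwise series to one that may be summed over the lattice
  term by term; each term has sum 0 because \<mu> has augmentation 1.\<close>

lemma act_wd_ell1:
  fixes k :: "int^'d \<Rightarrow>\<^sub>0 real"
  assumes d: "CARD('d) \<ge> 2" and k: "aug k = 0" and sm: "summable (\<lambda>N. l1 (k * walk ^ N))"
  shows "ell1 (act k wd)" and "infsum (act k wd) UNIV = 0"
proof -
  define f where "f N n = lookup (k * walk ^ N) n / (4 * real CARD('d))" for N n
  have f: "integrable (count_space UNIV) (f N)" for N
    using ell1_lookup[of "k * walk ^ N"] unfolding f_def[abs_def] ell1_def by simp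
  have fn: "(LINT n|count_space UNIV. norm (f N n)) = l1 (k * walk ^ N) / (4 * real CARD('d))" for N
    by (simp add: f_def integral_abs_lookup)
  have sums: "(\<lambda>N. f N n) sums act k wd n" for n
    unfolding f_def by (rule act_wd_sums[OF d k])
  have A: "AE n in count_space UNIV. summable (\<lambda>N. norm (f N n))"
  proof (rule AE_I2)
    fix n
    have "\<bar>lookup p n\<bar> \<le> l1 p" for p :: "int^'d \<Rightarrow>\<^sub>0 real"
      by (cases "n \<in> keys p") (auto simp: l1_def in_keys_iff intro: member_le_sum sum_nonneg)
    then have "norm (norm (f N n)) \<le> l1 (k * walk ^ N) / (4 * real CARD('d))" for N
      by (simp add: f_def divide_right_mono)
    then show "summable (\<lambda>N. norm (f N n))"
      by (intro summable_comparison_test'[OF summable_divide[OF sm]])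
  qed
  have B: "summable (\<lambda>N. LINT n|count_space UNIV. norm (f N n))"
    unfolding fn by (rule summable_divide[OF sm])
  have eq: "(\<lambda>n. suminf (\<lambda>N. f N n)) = act k wd"
    using sums by (auto simp: sums_iff)
  show *: "ell1 (act k wd)"
    using integrable_suminf[OF f A B] by (simp add: ell1_def eq)
  have "infsum (act k wd) UNIV = suminf (\<lambda>N. LINT n|count_space UNIV. f N n)"
    using integral_suminf[OF f A B] by (simp add: infsum_eq_integral[OF *] eq)
  also have "(\<lambda>N. LINT n|count_space UNIV. f N n) = (\<lambda>N. 0)"
    using k by (simp add: f_def integral_lookup aug_mult)
  finally show "infsum (act k wd) UNIV = 0" by simp
qed

section \<open>Periodic solutions of the Poisson equation\<close>

lemma act_sums:
  assumes "\<And>n. (\<lambda>j. D j n) sums z n"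
  shows "(\<lambda>j. act p (D j) n) sums act p z n"
  unfolding act_def by (intro sums_sum sums_mult assms)

lemma invariant_act: "invariant G u \<Longrightarrow> invariant G (act p u)"
  unfolding invariant_def
proof (intro ballI allI)
  fix \<gamma> n assume u: "\<forall>\<gamma>\<in>G. \<forall>n. u (n + \<gamma>) = u n" and "\<gamma> \<in> G"
  then have "(\<lambda>n. u (n + \<gamma>)) = u" by auto
  then show "act p u (n + \<gamma>) = act p u n" using act_shift[of p u \<gamma> n] by simp
qed

lemma finite_index_representatives:
  assumes "finite_index_subgroup G"
  obtains R where "finite R" "\<And>n. \<exists>r\<in>R. \<exists>\<gamma>\<in>G. n = r + \<gamma>"
proof -
  define coset where "coset n = (\<lambda>g. n + g) ` G" for n
  define R where "R = (\<lambda>C. SOME m. coset m = C) ` range coset"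
  have "finite R"
    using assms unfolding R_def finite_index_subgroup_def coset_def by blast
  moreover have "\<exists>r\<in>R. \<exists>\<gamma>\<in>G. n = r + \<gamma>" for n
  proof -
    have "coset (SOME m. coset m = coset n) = coset n" by (rule someI) (rule refl)
    moreover have "n \<in> coset n"
      using assms by (auto simp: coset_def finite_index_subgroup_def intro!: image_eqI[of _ _ 0])
    ultimately have "n \<in> coset (SOME m. coset m = coset n)" by simp
    then show ?thesis unfolding R_def coset_def[of "SOME m. coset m = coset n"] by blast
  qed
  ultimately show ?thesis by (rule that)
qed

text \<open>Some power of the walk halves the oscillation of every periodic function, so the Poisson
  equation is solved by a geometric series.\<close>

lemma periodic_oscillation_contraction:
  fixes G :: "(int^'d) set"
  assumes G: "finite_index_subgroup G"
  obtains N where "\<And>u B n. invariant G u \<Longrightarrow> (\<And>n. \<bar>u n - u 0\<bar> \<le> B)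
    \<Longrightarrow> \<bar>act (walk ^ N) u n - act (walk ^ N) u 0\<bar> \<le> B / 2"
proof -
  obtain R where R: "finite R" "\<And>n. \<exists>r\<in>R. \<exists>\<gamma>\<in>G. n = r + \<gamma>"
    using finite_index_representatives[OF G] by blast
  \<comment> \<open>Applied to u and read at 0, \<open>single (- r) 1\<close> gives the value u
    r.\<close>
  have "\<forall>\<^sub>F N in sequentially. l1 ((single (- r) 1 - 1) * (walk :: int^'d \<Rightarrow>\<^sub>0 real) ^ N) \<le> 1 / 2" for r
  proof -
    obtain C where C: "\<And>N. l1 ((single (- r) 1 - 1) * (walk :: int^'d \<Rightarrow>\<^sub>0 real) ^ N) \<le> C / sqrt (Suc N)"
      using walk_rate_translation[of "- r"] unfolding walk_rate_def by blast
    have "(\<lambda>N. C / sqrt (real (Suc N))) \<longlonglongrightarrow> 0" by real_asymp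
    then have "\<forall>\<^sub>F N in sequentially. C / sqrt (real (Suc N)) < 1 / 2"
      by (rule order_tendstoD) simp
    then show ?thesis by eventually_elim (rule order.trans[OF C less_imp_le])
  qed
  \<comment> \<open>There are finitely many cosets, so one N serves all representatives.\<close>
  then have "\<forall>\<^sub>F N in sequentially. \<forall>r\<in>R. l1 ((single (- r) 1 - 1) * (walk :: int^'d \<Rightarrow>\<^sub>0 real) ^ N) \<le> 1 / 2"
    using R(1) by (intro eventually_ball_finite) auto
  then obtain N where N: "\<And>r. r \<in> R \<Longrightarrow> l1 ((single (- r) 1 - 1) * (walk :: int^'d \<Rightarrow>\<^sub>0 real) ^ N) \<le> 1 / 2"
    unfolding eventually_sequentially by blast
  show ?thesis
  proof (rule that)
    fix u :: "int^'d \<Rightarrow> real" and B n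
    assume u: "invariant G u" and B: "\<And>n. \<bar>u n - u 0\<bar> \<le> B"
    obtain r \<gamma> where r: "r \<in> R" "\<gamma> \<in> G" "n = r + \<gamma>" using R(2) by blast
    \<comment> \<open>\<open>p\<close> has augmentation 0, so u may be replaced by u - u 0, which is
      bounded by B.\<close>
    define p where "p = (single (- r) 1 - 1) * (walk :: int^'d \<Rightarrow>\<^sub>0 real) ^ N"
    have augp: "act p (\<lambda>_. 1) 0 = 0"
      unfolding p_def aug_def[symmetric] aug_mult by (simp add: aug_def act_diff)
    have "act (walk ^ N) u n = act (walk ^ N) u r"
      using invariant_act[OF u] r by (simp add: invariant_def)
    then have "act (walk ^ N) u n - act (walk ^ N) u 0 = act p u 0"
      by (simp add: p_def act_mult act_diff)
    also have "\<dots> = act p (\<lambda>n. u n - u 0) 0"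
    proof -
      have "act p (\<lambda>_. u 0) 0 = 0" by (subst act_const) (simp add: augp)
      then show ?thesis by (simp add: act_diff_right)
    qed
    also have "\<bar>\<dots>\<bar> \<le> l1 p * B" by (rule act_bound) (rule B)
    also have "\<dots> \<le> 1 / 2 * B"
      using N[OF r(1)] B[of 0] by (intro mult_right_mono) (simp_all add: p_def)
    finally show "\<bar>act (walk ^ N) u n - act (walk ^ N) u 0\<bar> \<le> B / 2" by simp
  qed
qed

lemma periodic_poisson:
  fixes G :: "(int^'d) set" and v :: "int^'d \<Rightarrow> real"
  assumes G: "finite_index_subgroup G" and v: "invariant G v" and bdd: "\<And>n. \<bar>v n\<bar> \<le> B"
  obtains y C b where "invariant G y" "\<And>n. \<bar>y n\<bar> \<le> C" "\<And>n. v n = act lap y n + b"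
proof -
  obtain N where N: "\<And>u B n. invariant G u \<Longrightarrow> (\<And>n. \<bar>u n - u 0\<bar> \<le> B)
      \<Longrightarrow> \<bar>act (walk ^ N) u n - act (walk ^ N) u 0\<bar> \<le> B / 2"
    using periodic_oscillation_contraction[OF G] by blast
  define T where "T = (walk :: int^'d \<Rightarrow>\<^sub>0 real) ^ N"
  \<comment> \<open>Subtracting the value at 0 makes the series over j converge geometrically, and 1
    - T does not see the subtracted constants.\<close>
  define D where "D j n = act (T ^ j) v n - act (T ^ j) v 0" for j n
  have inv: "invariant G (act (T ^ j) v)" for j by (rule invariant_act[OF v])
  have D_bound: "\<bar>D j n\<bar> \<le> 2 * B * (1/2) ^ j" for j n
  proof (induction j arbitrary: n)
    case 0
    show ?case using bdd[of n] bdd[of 0] by (simp add: D_def)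
  next
    case (Suc j)
    have "\<bar>act T (act (T ^ j) v) n - act T (act (T ^ j) v) 0\<bar> \<le> 2 * B * (1/2) ^ j / 2"
      unfolding T_def[symmetric] using N[OF inv, of j "2 * B * (1/2) ^ j" n] Suc
      by (simp add: D_def T_def)
    then show ?case by (simp add: D_def act_mult)
  qed
  have sg: "summable (\<lambda>j. 2 * B * (1/2) ^ j)"
    by (intro summable_mult summable_geometric) simp
  have abs_sum: "summable (\<lambda>j. \<bar>D j n\<bar>)" for n
    by (rule summable_comparison_test'[OF sg, where N=0]) (simp only: real_norm_def abs_idempotent D_bound)
  define z where "z n = suminf (\<lambda>j. D j n)" for n
  have Dz: "(\<lambda>j. D j n) sums z n" for n
    unfolding z_def by (rule summable_sums[OF summable_rabs_cancel[OF abs_sum]])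
  have z_bdd: "\<bar>z n\<bar> \<le> suminf (\<lambda>j. 2 * B * (1/2) ^ j)" for n
    unfolding z_def by (rule order.trans[OF summable_rabs[OF abs_sum] suminf_le[OF D_bound abs_sum sg]])
  have z_inv: "invariant G z"
    using inv by (auto simp: invariant_def z_def D_def)
  have aug1T: "aug (1 - T) = 0"
    using aug_power[of "walk :: int^'d \<Rightarrow>\<^sub>0 real" N] by (simp add: aug_def act_diff T_def aug_walk[unfolded aug_def])
  have tele: "act (1 - T) (D j) n = act (T ^ j) v n - act (T ^ Suc j) v n" for j n
  proof -
    have "act (1 - T) (\<lambda>_. act (T ^ j) v 0) n = 0"
      by (subst act_const) (simp only: aug1T[unfolded aug_def] mult_zero_right)
    then have "act (1 - T) (D j) n = act (1 - T) (act (T ^ j) v) n"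
      unfolding D_def[abs_def] by (simp add: act_diff_right)
    then show ?thesis by (simp add: act_diff act_mult)
  qed
  have "(\<lambda>j. act (T ^ j) v n - act (T ^ Suc j) v n) sums act (1 - T) z n" for n
    using act_sums[of D z "1 - T" n, OF Dz] unfolding tele .
  then have "(\<lambda>M. \<Sum>j<M. act (T ^ j) v n - act (T ^ Suc j) v n) \<longlonglongrightarrow> act (1 - T) z n" for n
    by (simp add: sums_def)
  moreover have "(\<Sum>j<M. act (T ^ j) v n - act (T ^ Suc j) v n) = v n - act (T ^ M) v n" for M n
    by (induction M) auto
  ultimately have lim: "(\<lambda>M. v n - act (T ^ M) v n) \<longlonglongrightarrow> act (1 - T) z n" for n
    by simp
  have D0: "(\<lambda>M. D M n) \<longlonglongrightarrow> 0" for n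
    by (rule summable_LIMSEQ_zero[OF summable_rabs_cancel[OF abs_sum]])
  define b where "b = v 0 - act (1 - T) z 0"
  have solve: "v n = act (1 - T) z n + b" for n
  proof -
    \<comment> \<open>Comparing n with 0 cancels the limit of \<open>act (T ^ M) v\<close> up to the
      error \<open>D M n\<close>, which tends to 0; the combination is constantly v n - v 0.\<close>
    have "(\<lambda>M. (v n - act (T ^ M) v n) - (v 0 - act (T ^ M) v 0) + D M n) \<longlonglongrightarrow> act (1 - T) z n - act (1 - T) z 0 + 0"
      by (intro tendsto_intros lim D0)
    moreover have "(\<lambda>M. (v n - act (T ^ M) v n) - (v 0 - act (T ^ M) v 0) + D M n) = (\<lambda>_. v n - v 0)"
      by (simp add: D_def)
    ultimately have "(\<lambda>_::nat. v n - v 0) \<longlonglongrightarrow> act (1 - T) z n - act (1 - T) z 0 + 0"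
      by (simp only:)
    then have "v n - v 0 = act (1 - T) z n - act (1 - T) z 0 + 0"
      by (rule LIMSEQ_unique[OF tendsto_const])
    then show ?thesis by (simp add: b_def)
  qed
  \<comment> \<open>This is the quotient of 1 - walk^N by the Laplacian, so passing from z to
    \<open>act q z\<close> turns 1 - T into \<open>lap\<close>.\<close>
  define q where "q = single (0::int^'d) (1 / (4 * real CARD('d))) * (\<Sum>i<N. walk ^ i)"
  have "lap * q = (1 - walk) * (\<Sum>i<N. walk ^ i)"
    by (simp add: q_def walk_def mult_ac)
  then have lapq: "lap * q = 1 - T"
    by (simp add: T_def one_diff_power_eq)
  show ?thesis
  proof (rule that)
    show "invariant G (act q z)" by (rule invariant_act[OF z_inv])
    show "\<bar>act q z n\<bar> \<le> l1 q * suminf (\<lambda>j. 2 * B * (1/2) ^ j)" for n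
      by (rule act_bound) (rule z_bdd)
    show "v n = act lap (act q z) n + b" for n
      using solve by (simp add: act_mult[symmetric] lapq)
  qed
qed

section \<open>The kernel of the homomorphisms\<close>

lemma toP_zero: "toP (\<lambda>_. 0) = 0"
  by (simp add: toP_def rseq_def)

lemma lpoly_zero: "lpoly (\<lambda>_. 0)"
  by (simp add: lpoly_def)

lemma augId_iff: "h \<in> augId \<longleftrightarrow> lpoly h \<and> aug (toP h) = 0"
  by (auto simp: augId_def aug_eq_sum keys_toP lookup_toP simp flip: of_int_sum)

text \<open>The last two properties are the hypotheses of \<open>act_wd_ell1\<close>; being stable
  under sums, they can be followed along the generation of the ideal.\<close>

lemma augId3_properties:
  fixes k :: "int^'d \<Rightarrow> int"
  assumes "k \<in> augId3"
  shows "lpoly k" "aug (toP k) = 0" "summable (\<lambda>N. l1 (toP k * walk ^ N))"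
proof -
  have "lpoly k \<and> aug (toP k) = 0 \<and> summable (\<lambda>N. l1 (toP k * walk ^ N))"
    using assms unfolding augId3_def
  proof (induction rule: ideal_gen.induct)
    case zero
    then show ?case by (simp add: toP_zero lpoly_zero)
  next
    case (gen_mult s r p)
    then obtain h1 h2 h3 where s: "s = lpmult (lpmult h1 h2) h3" and h: "h1 \<in> augId" "h2 \<in> augId" "h3 \<in> augId"
      by blast
    have h': "lpoly h1" "lpoly h2" "lpoly h3" "aug (toP h1) = 0" "aug (toP h2) = 0" "aug (toP h3) = 0"
      using h by (auto simp: augId_iff)
    have s': "lpoly s" "toP s = toP h1 * toP h2 * toP h3"
      unfolding s using h' by (simp_all add: lpoly_lpmult toP_lpmult)
    have lp: "lpoly (lpmult r s)" "lpoly p" using gen_mult s' by (simp_all add: lpoly_lpmult)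
    have eq: "toP (\<lambda>n. lpmult r s n + p n) = toP r * (toP h1 * toP h2 * toP h3) + toP p"
      using toP_add[OF lp] toP_lpmult[OF gen_mult(2) s'(1)] s' by simp
    have "summable (\<lambda>N. l1 (toP r * (toP h1 * toP h2 * toP h3) * walk ^ N) + l1 (toP p * walk ^ N))"
      using gen_mult h' by (intro summable_add summable_l1_walk_triple) auto
    then have "summable (\<lambda>N. l1 (toP (\<lambda>n. lpmult r s n + p n) * walk ^ N))"
      unfolding eq distrib_right
      by (rule summable_comparison_test'[where N=0]) (simp add: l1_nonneg l1_add)
    moreover have "aug (toP (\<lambda>n. lpmult r s n + p n)) = 0"
      unfolding eq aug_add aug_mult using gen_mult h' by simp
    ultimately show ?case using lpoly_add[OF lp] by simp
  qed
  then show "lpoly k" "aug (toP k) = 0" "summable (\<lambda>N. l1 (toP k * walk ^ N))" by auto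
qed

lemma augId3_product:
  fixes h1 h2 h3 :: "int^'d \<Rightarrow> int"
  assumes "h1 \<in> augId" "h2 \<in> augId" "h3 \<in> augId"
  shows "lpmult (lpmult h1 h2) h3 \<in> augId3"
proof -
  define s where "s = lpmult (lpmult h1 h2) h3"
  \<comment> \<open>\<open>ideal_gen\<close> builds sums of multiples, so a generator enters with
    the unit of the ring as its coefficient.\<close>
  define e where "e n = (if n = 0 then 1 else 0 :: int)" for n :: "int^'d"
  have e: "{k. e k \<noteq> 0} = {0}" by (auto simp: e_def)
  have "(\<lambda>n. lpmult e s n + 0) \<in> augId3"
    unfolding augId3_def
    by (rule ideal_gen.gen_mult) (use assms e in \<open>auto simp: s_def lpoly_def intro: ideal_gen.zero\<close>)
  moreover have "(\<lambda>n. lpmult e s n + 0) = s"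
    by (simp add: lpmult_def e e_def)
  ultimately show ?thesis by (simp add: s_def)
qed

section \<open>Reflection and third differences\<close>

lemma lpoly_star: "lpoly g \<Longrightarrow> lpoly (star g)"
proof -
  assume "lpoly g"
  then have "finite (uminus ` {n. g n \<noteq> 0})" by (simp add: lpoly_def)
  moreover have "{n. star g n \<noteq> 0} \<subseteq> uminus ` {n. g n \<noteq> 0}"
  proof
    fix n assume "n \<in> {n. star g n \<noteq> 0}"
    then show "n \<in> uminus ` {n. g n \<noteq> 0}" by (intro image_eqI[of _ _ "- n"]) (auto simp: star_def)
  qed
  ultimately show "lpoly (star g)" unfolding lpoly_def by (rule finite_subset[rotated])
qed

text \<open>The shift action defining X_J reads y at m + n, whereas \<open>act\<close> reads n - k;
  reflection mediates between them.\<close>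

lemma act_star:
  assumes "lpoly g"
  shows "act (toP (star g)) v n = (\<Sum>m\<in>{m. g m \<noteq> 0}. real_of_int (g m) * v (m + n))"
  unfolding act_toP[OF lpoly_star[OF assms]]
  by (rule sum.reindex_bij_witness[of _ uminus uminus]) (auto simp: star_def add.commute)

lemma rho_in_X_iff:
  assumes "\<And>g. g \<in> J \<Longrightarrow> lpoly g"
  shows "rho_in_X J y \<longleftrightarrow> (\<forall>g\<in>J. \<forall>n. act (toP (star g)) y n \<in> \<int>)"
  unfolding rho_in_X_def using assms by (auto simp: act_star)

text \<open>This is the shift action of (u^a - 1)(u^b - 1)(u^c - 1), a product of three elements of
  the augmentation ideal.\<close>

lemma rho_in_X_third_difference:
  fixes y :: "int^'d \<Rightarrow> real"
  assumes y: "rho_in_X augId3 y"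
  shows "y (n + a + b + c) - y (n + a + b) - y (n + a + c) - y (n + b + c)
    + y (n + a) + y (n + b) + y (n + c) - y n \<in> \<int>"
proof -
  define u where "u a n = (if n = a then 1 else 0) - (if n = 0 then 1 else 0 :: int)" for a n :: "int^'d"
  have lu: "lpoly (u a)" for a
  proof -
    have "{n. u a n \<noteq> 0} \<subseteq> {a, 0}" by (auto simp: u_def)
    then show ?thesis unfolding lpoly_def by (rule finite_subset) simp
  qed
  have toPu: "toP (u a) = single a 1 - 1" for a
    by (rule poly_mapping_eqI)
      (auto simp: lookup_toP[OF lu] u_def lookup_minus lookup_single lookup_one when_def)
  have uI: "u a \<in> augId" for a
    unfolding augId_iff toPu using lu by (simp add: aug_def act_diff)
  define g where "g = lpmult (lpmult (u a) (u b)) (u c)"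
  have g3: "g \<in> augId3" unfolding g_def by (intro augId3_product uI)
  have lg: "lpoly g" by (rule augId3_properties[OF g3])
  \<comment> \<open>Reflecting both y and n turns the shift action into \<open>act (toP g)\<close>,
    whose factors are known explicitly.\<close>
  have "act (toP g) (star y) (- n) = act (toP (star g)) y n"
    using act_star[OF lg, of y n] by (simp add: act_toP[OF lg] star_def add.commute)
  also have "\<dots> \<in> \<int>"
    using y g3 augId3_properties(1) by (subst (asm) rho_in_X_iff) auto
  finally have "act (toP g) (star y) (- n) \<in> \<int>" .
  moreover have toPg: "toP g = (single a 1 - 1) * ((single b 1 - 1) * (single c 1 - 1))"
    unfolding g_def by (simp add: toP_lpmult lpoly_lpmult lu toPu mult.assoc)
  moreover have "act (toP g) (star y) (- n)
      = y (n + a + b + c) - y (n + a + b) - y (n + a + c) - y (n + b + c) + y (n + a) + y (n + b) + y (n + c) - y n"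
    by (simp only: toPg act_mult act_diff act_single act_one star_def) (simp add: algebra_simps)
  ultimately show ?thesis by simp
qed

text \<open>On each axis this is, up to sign, a third difference based at - e with increments e, e
  and n. It makes f y constant modulo 1, the source of c(y).\<close>

lemma act_lap_difference_Ints:
  fixes y :: "int^'d \<Rightarrow> real"
  assumes y: "rho_in_X augId3 y"
  shows "act lap y n - act lap y 0 \<in> \<int>"
proof -
  have "act lap y n - act lap y 0
      = (\<Sum>i\<in>UNIV. (2 * y n - y (n - axis i 1) - y (n + axis i 1)) - (2 * y 0 - y (- axis i 1) - y (axis i 1)))"
    by (simp add: act_lap sum_subtractf)
  also have "\<dots> \<in> \<int>"
  proof (rule Ints_sum)
    fix i :: 'd
    define e where "e = (axis i 1 :: int^'d)"
    have "- ((2 * y n - y (n - e) - y (n + e)) - (2 * y 0 - y (- e) - y e)) \<in> \<int>"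
      using rho_in_X_third_difference[OF y, of "- e" e e n] by (simp add: algebra_simps)
    then show "(2 * y n - y (n - axis i 1) - y (n + axis i 1)) - (2 * y 0 - y (- axis i 1) - y (axis i 1)) \<in> \<int>"
      unfolding e_def using Ints_minus by fastforce
  qed
  finally show ?thesis .
qed

section \<open>Pairing g w with f y + b\<close>

text \<open>The Laplacian is moved from y to g w, where f w = delta turns it into g; the constant b
  meets the sum of g w.\<close>

lemma conv_act_wd:
  fixes g :: "int^'d \<Rightarrow> int"
  assumes d: "CARD('d) \<ge> 2" and g: "lpoly g" and a: "ell1 (act (toP g) wd)" and y: "\<And>n. \<bar>y n\<bar> \<le> B"
  shows "act lap (act (toP g) wd) = rseq g"
    and "conv (act (toP g) wd) (\<lambda>n. act lap y n + b) n
      = act (toP g) y n + b * infsum (act (toP g) wd) UNIV"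
proof -
  have lapw: "act lap wd = (\<lambda>n::int^'d. if n = 0 then 1 else 0)"
    by (rule ext) (rule act_lap_wd[OF d])
  have "act lap (act (toP g) wd) n = act (toP g) (act lap wd) n" for n
    by (simp add: act_mult[symmetric] mult.commute)
  then show lapa: "act lap (act (toP g) wd) = rseq g"
    unfolding rseq_eq_lookup[OF g] lapw by (simp add: lookup_eq_act[symmetric] fun_eq_iff)
  have "\<bar>act lap y n\<bar> \<le> l1 (lap :: int^'d \<Rightarrow>\<^sub>0 real) * B" for n
    using y by (rule act_bound)
  note int = conv_integrable[OF a this]
  have intb: "integrable (count_space UNIV) (\<lambda>k. act (toP g) wd k * b)"
    using a by (simp add: ell1_def)
  have "conv (act (toP g) wd) (\<lambda>n. act lap y n + b) n
      = conv (act (toP g) wd) (act lap y) n + conv (act (toP g) wd) (\<lambda>_. b) n"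
  proof -
    have s: "f summable_on UNIV" if "integrable (count_space UNIV) f" for f :: "int^'d \<Rightarrow> real"
      using that abs_summable_summable[of f UNIV] by (simp add: ell1_def[symmetric] ell1_iff_summable)
    show ?thesis
      unfolding conv_def distrib_left by (rule infsum_add) (rule s[OF int], rule s[OF intb])
  qed
  also have "conv (act (toP g) wd) (act lap y) n = conv (rseq g) y n"
    unfolding conv_act_right[OF a y] conv_act_left[OF a y, symmetric] lapa ..
  finally show "conv (act (toP g) wd) (\<lambda>n. act lap y n + b) n
      = act (toP g) y n + b * infsum (act (toP g) wd) UNIV"
    by (simp only: conv_rseq[OF g] conv_const[OF a])
qed

lemma act_star_wd:
  fixes g :: "int^'d \<Rightarrow> int"
  assumes d: "CARD('d) \<ge> 2" and g: "lpoly g"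
  shows "act (toP (star g)) wd = (\<lambda>n. act (toP g) wd (- n))"
proof
  fix n :: "int^'d"
  have "- n - k = - (k + n)" for k by simp
  then have "wd (- n - k) = wd (k + n)" for k by (simp only: wd_minus[OF d])
  then show "act (toP (star g)) wd n = act (toP g) wd (- n)"
    by (simp add: act_star[OF g] act_toP[OF g])
qed

text \<open>The homomorphisms involve g^* while \<open>Iw\<close> restricts g; as w is even,
  reflection preserves summability.\<close>

lemma Iw_star:
  fixes g :: "int^'d \<Rightarrow> int"
  assumes d: "CARD('d) \<ge> 2" and g: "g \<in> Iw"
  shows "lpoly (star g)" "ell1 (act (toP (star g)) wd)"
proof -
  have lg: "lpoly g" and eg: "ell1 (act (toP g) wd)"
    using g by (auto simp: Iw_def ell1_iff_summable conv_rseq)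
  show "lpoly (star g)" by (rule lpoly_star[OF lg])
  note act_star_wd[OF d lg]
  moreover have "bij (uminus :: int^'d \<Rightarrow> int^'d)" by (rule bij_uminus)
  ultimately show "ell1 (act (toP (star g)) wd)"
    using ell1_reindex[of uminus "act (toP g) wd"] eg by simp
qed

lemma rho_in_X_imp_Ints:
  fixes y :: "int^'d \<Rightarrow> real" and g :: "int^'d \<Rightarrow> int"
  assumes y: "rho_in_X augId3 y" and g: "lpoly g" and a: "ell1 a" and eq: "act lap a = rseq g"
    and v: "act lap y n + b \<in> \<int>"
  shows "act (toP g) y n + b * infsum a UNIV \<in> \<int>"
proof -
  obtain A where A: "infsum a UNIV = real_of_int A"
    using infsum_Ints[OF g a eq] by (auto elim: Ints_cases)
  define k where "k m = g m + (- A) * fd m" for m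
  have lf: "lpoly (\<lambda>m. (- A) * fd (m :: int^'d))"
    using lpoly_fd unfolding lpoly_def by (rule finite_subset[rotated]) auto
  have k: "lpoly k" unfolding k_def by (rule lpoly_add[OF g lf])
  have "toP (\<lambda>m. (- A) * fd (m :: int^'d)) = single 0 (- real_of_int A) * lap"
    by (rule poly_mapping_eqI, subst lookup_toP[OF lf]) (simp add: lookup_mult_eq_act lookup_toP[OF lpoly_fd])
  then have toPk: "toP k = toP g + single 0 (- real_of_int A) * lap"
    unfolding k_def toP_add[OF g lf] by simp
  \<comment> \<open>Removing A times the delta from a gives a summable solution for \<open>k\<close>
    with sum 0, so that \<open>moment2\<close> vanishes on the diagonal too.\<close>
  define a' where "a' n = a n - real_of_int A * lookup 1 n" for n
  have int: "integrable (count_space UNIV) a" "integrable (count_space UNIV) (\<lambda>n::int^'d. real_of_int A * lookup 1 n)"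
    using a ell1_lookup[of "1 :: int^'d \<Rightarrow>\<^sub>0 real"] by (simp_all add: ell1_def)
  have a': "ell1 a'" unfolding ell1_def a'_def[abs_def] by (intro Bochner_Integration.integrable_diff int)
  have sum_a': "infsum a' UNIV = 0"
  proof -
    have "infsum a' UNIV = (LINT n|count_space UNIV. a n) - (LINT n|count_space (UNIV :: (int^'d) set). real_of_int A * lookup 1 n)"
      unfolding infsum_eq_integral[OF a'] a'_def using int by (rule Bochner_Integration.integral_diff)
    also have "\<dots> = infsum a UNIV - real_of_int A * aug (1 :: int^'d \<Rightarrow>\<^sub>0 real)"
      unfolding infsum_eq_integral[OF a] integral_lookup[symmetric] by simp
    finally show ?thesis by (simp add: A)
  qed
  have eq': "act lap a' = rseq k"
  proof
    fix n
    have "act lap a' n = act lap a n - real_of_int A * act lap (lookup 1) n"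
      unfolding a'_def[abs_def] act_diff_right act_scale_right ..
    also have "act lap (lookup 1) n = real_of_int (fd n)"
      unfolding lookup_mult_eq_act[symmetric] by (simp add: lookup_toP[OF lpoly_fd])
    finally show "act lap a' n = rseq k n" by (simp add: eq rseq_def k_def)
  qed
  define S where "S = {m. k m \<noteq> 0}"
  have "(\<Sum>m\<in>S. real_of_int (k m) * y (n - m)) \<in> \<int>"
  proof (rule third_differences_Ints_imp_sum_Ints[where y="\<lambda>m. y (n - m)"])
    fix a b c
    show "y (n - (a + b + c)) - y (n - (a + b)) - y (n - (a + c)) - y (n - (b + c))
        + y (n - a) + y (n - b) + y (n - c) - y (n - 0) \<in> \<int>"
      using rho_in_X_third_difference[OF y, of n "- a" "- b" "- c"] by (simp add: algebra_simps)
  next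
    show "(\<Sum>m\<in>S. real_of_int (k m)) = 0"
      unfolding S_def by (rule directional_moment0[OF k a' eq'])
    show "(\<Sum>m\<in>S. real_of_int (k m) * real_of_int (m $ i)) = 0" for i
      unfolding S_def by (rule moment1[OF k a' eq'])
    show "(\<Sum>m\<in>S. real_of_int (k m) * (real_of_int (m $ i) * real_of_int (m $ j))) = 0" for i j
      unfolding S_def moment2[OF k a' eq'] by (simp add: sum_a')
  qed
  then have "act (toP k) y n \<in> \<int>" by (simp add: act_toP[OF k] S_def)
  moreover have "act (toP k) y n = act (toP g) y n - real_of_int A * act lap y n"
    unfolding toPk by (simp add: act_add act_mult)
  ultimately have "act (toP g) y n - real_of_int A * act lap y n \<in> \<int>" by simp
  then have "(act (toP g) y n - real_of_int A * act lap y n) + real_of_int A * (act lap y n + b) \<in> \<int>"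
    by (rule Ints_add[OF _ Ints_mult[OF Ints_of_int v]])
  then show ?thesis by (simp add: A algebra_simps)
qed

section \<open>The two inclusions for K_d\<close>

lemma linf_conv_fd:
  fixes y :: "int^'d \<Rightarrow> real"
  assumes "y \<in> linf" shows "(\<lambda>n. act lap y n + c) \<in> linf"
proof -
  obtain B where B: "\<And>n. \<bar>y n\<bar> \<le> B" using assms by (auto simp: linf_def)
  have "\<bar>act lap y n + c\<bar> \<le> l1 (lap :: int^'d \<Rightarrow>\<^sub>0 real) * B + \<bar>c\<bar>" for n
    using act_bound[of y B lap n, OF B] by linarith
  then show ?thesis unfolding linf_def by blast
qed

lemma in_Kd:
  fixes y :: "int^'d \<Rightarrow> real"
  assumes d: "CARD('d) \<ge> 2" and y: "y \<in> linf" "rho_in_X augId3 y" and v: "\<And>n. act lap y n + b \<in> \<int>"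
  shows "(\<lambda>n. act lap y n + b) \<in> Kd"
proof -
  obtain B where B: "\<And>n. \<bar>y n\<bar> \<le> B" using y by (auto simp: linf_def)
  have "(\<lambda>n. act lap y n + b) \<in> linf_int"
    using linf_conv_fd[OF y(1)] v by (simp add: linf_int_def)
  moreover have "conv (conv (rseq (star g)) wd) (\<lambda>n. act lap y n + b) n \<in> \<int>" if "g \<in> Iw" for g n
  proof -
    note s = Iw_star[OF d that]
    note c = conv_act_wd[OF d s B]
    show ?thesis
      unfolding conv_rseq[OF s(1)] c(2) by (rule rho_in_X_imp_Ints[OF y(2) s c(1) v])
  qed
  ultimately show ?thesis by (simp add: Kd_def)
qed

text \<open>The periodic solution of the Poisson equation already serves as y: testing v against k
  in the cube yields k^* y plus b times the sum of k^* w, and this sum is 0.\<close>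

lemma Kd_periodic:
  fixes v :: "int^'d \<Rightarrow> real"
  assumes d: "CARD('d) \<ge> 2" and G: "finite_index_subgroup G" and inv: "invariant G v" and v: "v \<in> Kd"
  obtains y b where "y \<in> linf" "invariant G y" "rho_in_X augId3 y" "\<And>n. v n = act lap y n + b"
proof -
  have "v \<in> linf_int" using v by (simp add: Kd_def)
  then obtain B where B: "\<And>n. \<bar>v n\<bar> \<le> B" by (auto simp: linf_int_def linf_def)
  obtain y C b where y: "invariant G y" "\<And>n. \<bar>y n\<bar> \<le> C" "\<And>n. v n = act lap y n + b"
    by (rule periodic_poisson[OF G inv B]) (rule that)
  have veq: "v = (\<lambda>n. act lap y n + b)" using y(3) by auto
  have "act (toP (star k)) y n \<in> \<int>" if k: "k \<in> augId3" for k n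
  proof -
    note kp = augId3_properties[OF k]
    have kI: "k \<in> Iw"
      using act_wd_ell1(1)[OF d kp(2,3)] kp(1) by (simp add: Iw_def ell1_iff_summable conv_rseq)
    note s = Iw_star[OF d kI]
    note c = conv_act_wd[OF d s y(2)]
    have "conv (conv (rseq (star k)) wd) v n \<in> \<int>" using v kI by (simp add: Kd_def)
    moreover have "infsum (act (toP (star k)) wd) UNIV = 0"
    proof -
      have "infsum (act (toP (star k)) wd) UNIV = infsum (\<lambda>n. act (toP k) wd (- n)) UNIV"
        by (simp only: act_star_wd[OF d kp(1)])
      also have "\<dots> = infsum (act (toP k) wd) UNIV"
        by (rule infsum_reindex_bij_betw) (rule bij_uminus)
      finally show ?thesis using act_wd_ell1(2)[OF d kp(2,3)] by simp
    qed
    ultimately show ?thesis unfolding conv_rseq[OF s(1)] veq c(2) by simp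
  qed
  then have "rho_in_X augId3 y"
    by (subst rho_in_X_iff) (auto intro: augId3_properties(1))
  moreover have "y \<in> linf" using y(2) by (auto simp: linf_def)
  ultimately show ?thesis using y that by blast
qed

theorem theorem3p11:
  assumes "CARD('d::finite) \<ge> 2"
  shows
  "(\<forall>y :: int^'d \<Rightarrow> real. y \<in> linf \<and> rho_in_X augId3 y \<longrightarrow>
      (\<exists>!c. 0 \<le> c \<and> c < 1 \<and> (\<lambda>n. conv (rseq fd) y n + c) \<in> linf_int) \<and>
      (\<forall>c. 0 \<le> c \<and> c < 1 \<and> (\<lambda>n. conv (rseq fd) y n + c) \<in> linf_int \<longrightarrow>
         (\<forall>m::int. (\<lambda>n. conv (rseq fd) y n + c + of_int m) \<in> Kd)))
   \<and>
   (\<forall>(G :: (int^'d) set) (v :: int^'d \<Rightarrow> real).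
      finite_index_subgroup G \<and> v \<in> linf_int \<and> invariant G v \<longrightarrow>
      (v \<in> Kd \<longleftrightarrow>
        (\<exists>y c (m::int). y \<in> linf \<and> invariant G y \<and> rho_in_X augId3 y \<and>
           0 \<le> c \<and> c < 1 \<and> (\<lambda>n. conv (rseq fd) y n + c) \<in> linf_int \<and>
           v = (\<lambda>n. conv (rseq fd) y n + c + of_int m))))"
proof -
  have conv: "conv (rseq fd) y = act lap y" for y :: "int^'d \<Rightarrow> real"
    by (rule conv_rseq[OF lpoly_fd])
  have Kd: "(\<lambda>n. act lap y n + c + of_int m) \<in> Kd"
    if y: "y \<in> linf" "rho_in_X augId3 y" and c: "(\<lambda>n. act lap y n + c) \<in> linf_int"
    for y :: "int^'d \<Rightarrow> real" and c and m :: int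
  proof -
    have "act lap y n + c \<in> \<int>" for n using c by (simp add: linf_int_def)
    then have "(act lap y n + c) + of_int m \<in> \<int>" for n by (rule Ints_add) simp
    then have "act lap y n + (c + of_int m) \<in> \<int>" for n by (simp only: add.assoc)
    from in_Kd[OF assms y this] show ?thesis by (simp add: add.assoc)
  qed
  have ex1: "\<exists>!c. 0 \<le> c \<and> c < 1 \<and> (\<lambda>n. act lap y n + c) \<in> linf_int"
    if y: "y \<in> linf" "rho_in_X augId3 y" for y :: "int^'d \<Rightarrow> real"
  proof (rule ex1I)
    \<comment> \<open>The representative in [0, 1) that makes the value at 0 integral; the other
      points follow because f y is constant modulo 1.\<close>
    define c where "c = frac (- act lap y 0)"
    have "act lap y n + c \<in> \<int>" for n
    proof -
      have eq: "act lap y n + c = (act lap y n - act lap y 0) - of_int \<lfloor>- act lap y 0\<rfloor>"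
        by (simp add: c_def frac_def)
      show ?thesis
        unfolding eq by (rule Ints_diff[OF act_lap_difference_Ints[OF y(2)] Ints_of_int])
    qed
    then show "0 \<le> c \<and> c < 1 \<and> (\<lambda>n. act lap y n + c) \<in> linf_int"
      using linf_conv_fd[OF y(1)] by (simp add: linf_int_def c_def frac_lt_1)
    fix c'
    assume c': "0 \<le> c' \<and> c' < 1 \<and> (\<lambda>n. act lap y n + c') \<in> linf_int"
    then have "act lap y 0 + c' \<in> \<int>" by (simp add: linf_int_def)
    then obtain z where "act lap y 0 + c' = of_int z" by (auto elim: Ints_cases)
    then have "- act lap y 0 - c' = of_int (- z)" by simp
    then have "- act lap y 0 - c' \<in> \<int>" by (simp only: Ints_of_int)
    then have "frac (- act lap y 0) = c'" using c' by (simp only: frac_unique_iff)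
    then show "c' = c" by (simp add: c_def)
  qed
  have iff: "v \<in> Kd \<longleftrightarrow>
        (\<exists>y c (m::int). y \<in> linf \<and> invariant G y \<and> rho_in_X augId3 y \<and>
           0 \<le> c \<and> c < 1 \<and> (\<lambda>n. act lap y n + c) \<in> linf_int \<and>
           v = (\<lambda>n. act lap y n + c + of_int m))"
    if G: "finite_index_subgroup G" and v: "v \<in> linf_int" "invariant G v" for G and v :: "int^'d \<Rightarrow> real"
  proof
    assume "v \<in> Kd"
    then obtain y b where y: "y \<in> linf" "invariant G y" "rho_in_X augId3 y" "\<And>n. v n = act lap y n + b"
      using Kd_periodic[OF assms G v(2)] by blast
    \<comment> \<open>The constant b splits into its fractional part, taken as c, and its floor,
      taken as m.\<close>
    have "act lap y n + frac b = v n - of_int \<lfloor>b\<rfloor>" for n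
      using y(4)[of n] by (simp add: frac_def)
    moreover have "v n - of_int \<lfloor>b\<rfloor> \<in> \<int>" for n using v(1) by (simp add: linf_int_def)
    ultimately have "act lap y n + frac b \<in> \<int>" for n by (simp only:)
    then have "(\<lambda>n. act lap y n + frac b) \<in> linf_int"
      using linf_conv_fd[OF y(1)] unfolding linf_int_def by blast
    moreover have "v = (\<lambda>n. act lap y n + frac b + of_int \<lfloor>b\<rfloor>)"
      using y(4) by (auto simp: frac_def)
    ultimately show "\<exists>y c (m::int). y \<in> linf \<and> invariant G y \<and> rho_in_X augId3 y \<and>
           0 \<le> c \<and> c < 1 \<and> (\<lambda>n. act lap y n + c) \<in> linf_int \<and>
           v = (\<lambda>n. act lap y n + c + of_int m)"
      using y by (intro exI[of _ y] exI[of _ "frac b"] exI[of _ "\<lfloor>b\<rfloor>"]) (simp add: frac_lt_1)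
  qed (auto intro: Kd)
  show ?thesis unfolding conv using ex1 Kd iff by blast
qed
end
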